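(* Let $\Omega_1\subseteq[\mu_{\min},\infty)$ be the set of all Laplacian limit points produced by the classic Laplacian Shearer method and $\Omega\subseteq[\mu_{\min},\infty)$ the set of all Laplacian limit points produced by the generalized random Shearer process (all defined in the context). Then the generalized random process, already run with $\mu=5.4$, produces a Laplacian limit point in the interval $(\mu_*,\mu^* )$, where $\mu_*=\frac{5+\sqrt{33}}2\approx5.3722$ and $\mu^*\approx5.4207$ is the largest root of $2x^4-14x^3+19x^2-10x-1$. Thus the generalized random process generates Laplacian limit points that are not achieved by the classic method using caterpillars, that is, $\Omega_1\subsetneq\Omega$.
   Context: For a finite graph $G$, $\rho_L(G)$ is the largest eigenvalue of the Laplacian matrix $L(G)=D(G)-A(G)$. Let $\mu_{\min}=2+\omega+\omega^{-1}\approx4.38$ with $\omega=\frac13\left(\sqrt[3]{19+3\sqrt{33}}+\sqrt[3]{19-3\sqrt{33}}+1\right)$. For given $\mu$ put $\theta=\frac{-(\mu-2)-\sqrt{(\mu-2)^2-4}}{2}$, $\theta'=\theta^{-1}=\frac{-(\mu-2)+\sqrt{(\mu-2)^2-4}}{2}$ and $\psi(t)=2-\mu-\frac1t$ for $t\ne0$. Classic method. The caterpillar $[r_1,\dots,r_k]$ is the tree obtained from a path $v_1\cdots v_k$ by attaching $r_i$ leaves at $v_i$. For $\mu\ge\mu_{\min}$ and $k\ge2$ let $G_k(\mu)=[r_1,\dots,r_k]$ where $r_1=\left\lfloor\frac{\mu-1}{\mu}(\theta'-(1-\mu))\right\rfloor$, $S_1=1-\mu+r_1\frac{\mu}{\mu-1}$;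 for $2\le j\le k-1$: $r_j=\left\lfloor\frac{\mu-1}{\mu}(\theta'-\psi(S_{j-1}))\right\rfloor$, $S_j=\psi(S_{j-1})+r_j\frac{\mu}{\mu-1}$; $r_k=\left\lfloor\frac{\mu-1}{\mu}(\theta'+1-\psi(S_{k-1}))\right\rfloor$. The limit $\lim_k\rho_L(G_k(\mu))$ exists and is at most $\mu$. $\Omega_1$ is the set of all numbers in $[\mu_{\min},\infty)$ that are such a limit for some $\mu\ge\mu_{\min}$. Generalized random process. A starlike tree is encoded as $T=[q_1,\dots,q_r]$ with positive integers $q_1\le\dots\le q_r$, or $T=[0]$ (empty). The linear tree $[T_1,\dots,T_k]$ is obtained from a path $v_1\cdots v_k$ by attaching at each $v_j$, for $T_j=[q_1,\dots,q_r]$, $r$ disjoint pendant paths with $q_1,\dots,q_r$ vertices (an end vertex of each is joined to $v_j$); nothing is attached if $T_j=[0]$. With $b_1=1-\mu$, $b_{i+1}=2-\mu-1/b_i$, put $\delta([q_1,\dots,q_r],\mu)=\sum_{i=1}^r(1-1/b_{q_i})$ and $\delta([0],\mu)=0$. For $\mu>\mu_{\min}$, a realization of the process is any sequence of starlike trees $(T_1,T_2,\dots)$ with $S_1:=1-\mu+\delta(T_1,\mu)<\theta^{-1}$ and $S_j:=\psi(S_{j-1})+\delta(T_j,\mu)<\theta^{-1}$ for all $j\ge2$; put $G_k=[T_1,\dots,T_k]$. The limit $\lim_k\rho_L(G_k)$ exists and is at most $\mu$. $\Omega$ is the set of all numbers in $[\mu_{\min},\infty)$ that are such a limit for some $\mu>\mu_{\min}$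 and some realization. *)

theory Defs
  imports Complex_Main "Jordan_Normal_Form.Spectral_Radius"
begin

subsection \<open>Laplacian spectral radius of a finite graph\<close>

text \<open>A graph is a vertex set with an adjacency relation; only the restriction of the
  relation to the vertex set matters.\<close>

type_synonym 'a graph = "'a set \<times> ('a \<Rightarrow> 'a \<Rightarrow> bool)"

definition simple_graph :: "'a graph \<Rightarrow> bool" where
  "simple_graph G \<longleftrightarrow> finite (fst G) \<and>
     (\<forall>u\<in>fst G. \<not> snd G u u) \<and> (\<forall>u\<in>fst G. \<forall>v\<in>fst G. snd G u v \<longrightarrow> snd G v u)"

definition degree_matrix :: "'a list \<Rightarrow> ('a \<Rightarrow> 'a \<Rightarrow> bool) \<Rightarrow> real mat" where
  "degree_matrix vs E = mat (length vs) (length vs)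
     (\<lambda>(i, j). if i = j then real (card {u \<in> set vs. E (vs ! i) u}) else 0)"

definition adjacency_matrix :: "'a list \<Rightarrow> ('a \<Rightarrow> 'a \<Rightarrow> bool) \<Rightarrow> real mat" where
  "adjacency_matrix vs E = mat (length vs) (length vs)
     (\<lambda>(i, j). if E (vs ! i) (vs ! j) then 1 else 0)"

definition laplacian_matrix :: "'a list \<Rightarrow> ('a \<Rightarrow> 'a \<Rightarrow> bool) \<Rightarrow> real mat" where
  "laplacian_matrix vs E = degree_matrix vs E - adjacency_matrix vs E"

text \<open>Different enumerations of the vertices give permutation-similar matrices, so the value
  does not depend on the one chosen. For a simple graph the matrix is real symmetric, so its
  spectrum over the reals is its whole spectrum.\<close>

definition rho_L :: "'a graph \<Rightarrow> real" where
  "rho_L G = Max (spectrum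
     (laplacian_matrix (SOME vs. distinct vs \<and> set vs = fst G) (snd G)))"

subsection \<open>Linear trees and caterpillars\<close>

text \<open>Indices start at 0: \<open>Spine j\<close> is the path vertex $v_{j+1}$, and \<open>Branch j i m\<close> is the
  vertex at distance \<open>m + 1\<close> from \<open>Spine j\<close> on the \<open>i\<close>-th pendant path attached there.\<close>

datatype vertex = Spine nat | Branch nat nat nat

fun next_vertex :: "vertex \<Rightarrow> vertex \<Rightarrow> bool" where
  "next_vertex (Spine j) (Spine j') \<longleftrightarrow> j' = Suc j"
| "next_vertex (Spine j) (Branch j' i m) \<longleftrightarrow> j' = j \<and> m = 0"
| "next_vertex (Branch j i m) (Branch j' i' m') \<longleftrightarrow> j' = j \<and> i' = i \<and> m' = Suc m"
| "next_vertex (Branch j i m) (Spine j') \<longleftrightarrow> False"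

definition linear_tree_vertices :: "nat list list \<Rightarrow> vertex set" where
  "linear_tree_vertices Ts = {Spine j |j. j < length Ts} \<union>
     {Branch j i m |j i m. j < length Ts \<and> i < length (Ts ! j) \<and> m < Ts ! j ! i}"

definition linear_tree :: "nat list list \<Rightarrow> vertex graph" where
  "linear_tree Ts = (linear_tree_vertices Ts, \<lambda>u v. next_vertex u v \<or> next_vertex v u)"

lemma simple_graph_linear_tree: "simple_graph (linear_tree Ts)"
proof -
  have "linear_tree_vertices Ts \<subseteq> Spine ` {..<length Ts} \<union>
      (\<Union>j<length Ts. \<Union>i<length (Ts ! j). Branch j i ` {..<Ts ! j ! i})"
    by (auto simp: linear_tree_vertices_def)
  then have "finite (linear_tree_vertices Ts)"
    by (rule finite_subset) auto
  moreover have "\<not> next_vertex u u" for u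
    by (cases u) auto
  ultimately show ?thesis
    by (auto simp: simple_graph_def linear_tree_def)
qed

definition caterpillar :: "nat list \<Rightarrow> vertex graph" where
  "caterpillar rs = linear_tree (map (\<lambda>r. replicate r 1) rs)"

subsection \<open>Constants\<close>

definition omega :: real where
  "omega = (root 3 (19 + 3 * sqrt 33) + root 3 (19 - 3 * sqrt 33) + 1) / 3"

definition mu_min :: real where
  "mu_min = 2 + omega + inverse omega"

definition mu_lower :: real where
  "mu_lower = (5 + sqrt 33) / 2"

text \<open>The largest real root of $2x^4-14x^3+19x^2-10x-1$.\<close>

definition mu_upper :: real where
  "mu_upper = Max {x. poly [:-1, -10, 19, -14, 2:] x = 0}"

definition theta :: "real \<Rightarrow> real" where
  "theta \<mu> = (- (\<mu> - 2) - sqrt ((\<mu> - 2)\<^sup>2 - 4)) / 2"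

definition theta' :: "real \<Rightarrow> real" where
  "theta' \<mu> = inverse (theta \<mu>)"

definition psi :: "real \<Rightarrow> real \<Rightarrow> real" where
  "psi \<mu> t = 2 - \<mu> - 1 / t"

subsection \<open>The classic method\<close>

text \<open>The number of leaves prescribed when \<open>t\<close> is the value before attaching them and \<open>c\<close> is the
  bound not to be exceeded. In the process the floor is never negative.\<close>

definition leaf_count :: "real \<Rightarrow> real \<Rightarrow> real \<Rightarrow> nat" where
  "leaf_count \<mu> c t = nat \<lfloor>(\<mu> - 1) / \<mu> * (c - t)\<rfloor>"

text \<open>\<open>classic_S \<mu> j\<close> and \<open>classic_r \<mu> j\<close> are $S_{j+1}$ and, for a vertex that is not the last
  one, $r_{j+1}$.\<close>

primrec classic_S :: "real \<Rightarrow> nat \<Rightarrow> real" where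
  "classic_S \<mu> 0 =
     1 - \<mu> + real (leaf_count \<mu> (theta' \<mu>) (1 - \<mu>)) * (\<mu> / (\<mu> - 1))"
| "classic_S \<mu> (Suc j) =
     psi \<mu> (classic_S \<mu> j)
     + real (leaf_count \<mu> (theta' \<mu>) (psi \<mu> (classic_S \<mu> j))) * (\<mu> / (\<mu> - 1))"

primrec classic_r :: "real \<Rightarrow> nat \<Rightarrow> nat" where
  "classic_r \<mu> 0 = leaf_count \<mu> (theta' \<mu>) (1 - \<mu>)"
| "classic_r \<mu> (Suc j) = leaf_count \<mu> (theta' \<mu>) (psi \<mu> (classic_S \<mu> j))"

text \<open>Meaningful for \<open>k \<ge> 2\<close> only. The last entry uses $S_{k-1}$, which is
  \<open>classic_S \<mu> (k - 2)\<close>.\<close>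

definition classic_G :: "real \<Rightarrow> nat \<Rightarrow> vertex graph" where
  "classic_G \<mu> k = caterpillar (map (classic_r \<mu>) [0..<k - 1] @
     [leaf_count \<mu> (theta' \<mu> + 1) (psi \<mu> (classic_S \<mu> (k - 2)))])"

definition classic_limit :: "real \<Rightarrow> real \<Rightarrow> bool" where
  "classic_limit \<mu> x \<longleftrightarrow> (\<lambda>k. rho_L (classic_G \<mu> k)) \<longlonglongrightarrow> x"

definition Omega1 :: "real set" where
  "Omega1 = {x. x \<ge> mu_min \<and> (\<exists>\<mu>\<ge>mu_min. classic_limit \<mu> x)}"

subsection \<open>The generalized random process\<close>

definition starlike :: "nat list \<Rightarrow> bool" where
  "starlike T \<longleftrightarrow> T = [0] \<or> (T \<noteq> [] \<and> sorted T \<and> (\<forall>q\<in>set T. q > 0))"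

text \<open>\<open>b_seq \<mu> i\<close> is $b_i$, used for \<open>i \<ge> 1\<close> only.\<close>

definition b_seq :: "real \<Rightarrow> nat \<Rightarrow> real" where
  "b_seq \<mu> i = (psi \<mu> ^^ (i - 1)) (1 - \<mu>)"

definition delta :: "nat list \<Rightarrow> real \<Rightarrow> real" where
  "delta T \<mu> = (if T = [0] then 0 else (\<Sum>q\<leftarrow>T. 1 - 1 / b_seq \<mu> q))"

text \<open>\<open>T j\<close> and \<open>process_S \<mu> T j\<close> are $T_{j+1}$ and $S_{j+1}$.\<close>

primrec process_S :: "real \<Rightarrow> (nat \<Rightarrow> nat list) \<Rightarrow> nat \<Rightarrow> real" where
  "process_S \<mu> T 0 = 1 - \<mu> + delta (T 0) \<mu>"
| "process_S \<mu> T (Suc j) = psi \<mu> (process_S \<mu> T j) + delta (T (Suc j)) \<mu>"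

definition realization :: "real \<Rightarrow> (nat \<Rightarrow> nat list) \<Rightarrow> bool" where
  "realization \<mu> T \<longleftrightarrow> (\<forall>j. starlike (T j) \<and> process_S \<mu> T j < inverse (theta \<mu>))"

definition process_G :: "(nat \<Rightarrow> nat list) \<Rightarrow> nat \<Rightarrow> vertex graph" where
  "process_G T k = linear_tree (map T [0..<k])"

definition process_limit :: "real \<Rightarrow> real \<Rightarrow> bool" where
  "process_limit \<mu> x \<longleftrightarrow>
     (\<exists>T. realization \<mu> T \<and> (\<lambda>k. rho_L (process_G T k)) \<longlonglongrightarrow> x)"

definition Omega :: "real set" where
  "Omega = {x. x \<ge> mu_min \<and> (\<exists>\<mu>>mu_min. process_limit \<mu> x)}"

end

theory Submission
  imports Defs "HOL-Analysis.Function_Topology"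
begin

text \<open>
  By the Rayleigh principle, bounds on \<open>rho_L\<close> are bounds on the form
  \<open>\<Sum>(f u - f v)\<^sup>2\<close> over the edges. Orient a linear tree along \<open>next_vertex\<close> and split every edge term as
  \<open>(f u - f v)\<^sup>2 \<le> (1 + w) (f u)\<^sup>2 + (1 + 1/w) (f v)\<^sup>2\<close>, with equality iff \<open>f v = - w * f u\<close>. With
  the weights \<open>- S\<^sub>j\<close> on the spine and \<open>- 1 / b\<^sub>i\<close> on the branches the coefficient of every \<open>(f v)\<^sup>2\<close>
  becomes exactly \<open>\<mu>\<close>. Hence a supersolution of the recursion for \<open>S\<close> that stays negative gives
  \<open>rho_L \<le> \<mu>\<close>, and a subsolution that reaches a nonnegative value before the last spine vertex gives
  \<open>\<mu> \<le> rho_L\<close>.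

  No limit point of the classic process lies strictly between \<open>5.373\<close> and \<open>5.401\<close>. For
  \<open>\<mu> \<le> 5.373\<close> the limit is at most \<open>\<mu>\<close>. For larger \<open>\<mu>\<close> the first vertex carries at least three
  leaves. Either it carries four, or the first later leaf count different from 1 is at least 2, and then the
  graphs have spectral radius at least \<open>5.401\<close>; or the sequence is \<open>[3, 1, 1, \<dots>]\<close>, whose graphs have spectral
  radius at most \<open>5.373\<close>. The sequence \<open>[1,1,1], [2], [2], [1], [0], [0], \<dots>\<close> is a realization at
  \<open>\<mu> = 5.4\<close> with limit in the interval from \<open>5.374\<close> to \<open>5.4\<close>.

  For the inclusion, the leaf counts of a classic run are bounded, so they form a realization for a large
  parameter; as the final leaf count of a classic graph exceeds the regular one by at most 1 and the next spine
  vertex can play the extra leaf, the classic graphs are sandwiched between consecutive process graphs.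
\<close>

subsection \<open>The Rayleigh principle for the Laplacian\<close>

text \<open>Acting on functions of the vertices frees the variational arguments from the arbitrary
  enumeration inside \<open>rho_L\<close>.\<close>

definition lap :: "'a graph \<Rightarrow> ('a \<Rightarrow> real) \<Rightarrow> 'a \<Rightarrow> real" where
  "lap G f v = (\<Sum>u | u \<in> fst G \<and> snd G v u. f v - f u)"

definition lap_form :: "'a graph \<Rightarrow> ('a \<Rightarrow> real) \<Rightarrow> real" where
  "lap_form G f = (\<Sum>v\<in>fst G. f v * lap G f v)"

lemma laplacian_matrix_mult_vec:
  assumes "distinct vs" and "i < length vs"
  shows "(laplacian_matrix vs E *\<^sub>v vec (length vs) (\<lambda>j. f (vs ! j))) $ i = lap (set vs, E) f (vs ! i)"
proof -
  let ?n = "length vs" and ?N = "{u \<in> set vs. E (vs ! i) u}"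
  have "(laplacian_matrix vs E *\<^sub>v vec ?n (\<lambda>j. f (vs ! j))) $ i =
      (\<Sum>j<?n. ((if i = j then real (card ?N) else 0) - (if E (vs ! i) (vs ! j) then 1 else 0)) * f (vs ! j))"
    using assms(2)
    by (auto simp: laplacian_matrix_def degree_matrix_def adjacency_matrix_def scalar_prod_def
        atLeast0LessThan intro!: sum.cong)
  also have "\<dots> = (\<Sum>j<?n. (if i = j then real (card ?N) * f (vs ! j) else 0)
      - (if E (vs ! i) (vs ! j) then f (vs ! j) else 0))"
    by (intro sum.cong) (auto simp: algebra_simps)
  also have "\<dots> = real (card ?N) * f (vs ! i) - (\<Sum>j<?n. if E (vs ! i) (vs ! j) then f (vs ! j) else 0)"
    using assms(2) by (simp add: sum_subtractf)
  also have "(\<Sum>j<?n. if E (vs ! i) (vs ! j) then f (vs ! j) else 0) =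
      (\<Sum>u\<in>set vs. if E (vs ! i) u then f u else 0)"
    using bij_betw_nth[OF assms(1) refl refl] by (intro sum.reindex_bij_betw)
  also have "\<dots> = (\<Sum>u\<in>?N. f u)"
    by (simp add: sum.If_cases Int_def)
  finally show ?thesis
    by (simp add: lap_def sum_subtractf)
qed

lemma spectrum_laplacian_matrix_iff:
  assumes "distinct vs"
  shows "m \<in> spectrum (laplacian_matrix vs E) \<longleftrightarrow>
    (\<exists>f. (\<exists>v\<in>set vs. f v \<noteq> 0) \<and> (\<forall>v\<in>set vs. lap (set vs, E) f v = m * f v))"
    (is "?L \<longleftrightarrow> ?R")
proof
  have dim: "dim_row (laplacian_matrix vs E) = length vs"
    by (simp add: laplacian_matrix_def adjacency_matrix_def)
  {
    assume ?L
    then obtain x where x: "x \<in> carrier_vec (length vs)" "x \<noteq> 0\<^sub>v (length vs)"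
      "laplacian_matrix vs E *\<^sub>v x = m \<cdot>\<^sub>v x"
      by (auto simp: spectrum_def eigenvalue_def eigenvector_def dim)
    define f where "f v = x $ the_inv_into {..<length vs} ((!) vs) v" for v
    have inj: "inj_on ((!) vs) {..<length vs}"
      using assms by (simp add: inj_on_nth)
    have f: "f (vs ! i) = x $ i" if "i < length vs" for i
      using that by (simp add: f_def the_inv_into_f_f[OF inj])
    have xf: "x = vec (length vs) (\<lambda>j. f (vs ! j))"
      using x(1) f by (intro eq_vecI) auto
    have "lap (set vs, E) f (vs ! i) = m * f (vs ! i)" if "i < length vs" for i
    proof -
      have "lap (set vs, E) f (vs ! i) = (laplacian_matrix vs E *\<^sub>v x) $ i"
        using laplacian_matrix_mult_vec[OF assms that, of E f] by (simp add: xf)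
      then show ?thesis
        using x that f by simp
    qed
    moreover obtain i where "i < length vs" "x $ i \<noteq> 0"
      using x by (metis carrier_vecD eq_vecI index_zero_vec)
    ultimately show ?R
      using f by (metis in_set_conv_nth)
  }
  {
    assume ?R
    then obtain f where f: "\<exists>v\<in>set vs. f v \<noteq> 0" "\<And>v. v \<in> set vs \<Longrightarrow> lap (set vs, E) f v = m * f v"
      by blast
    let ?x = "vec (length vs) (\<lambda>j. f (vs ! j))"
    have "laplacian_matrix vs E *\<^sub>v ?x = m \<cdot>\<^sub>v ?x"
      using laplacian_matrix_mult_vec[OF assms, of _ E f] f(2) dim by (intro eq_vecI) auto
    moreover have "?x \<noteq> 0\<^sub>v (length vs)"
      using f(1) by (metis in_set_conv_nth index_vec index_zero_vec(1))
    ultimately show ?L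
      unfolding spectrum_def eigenvalue_def eigenvector_def dim
      by (intro CollectI exI[of _ ?x]) simp
  }
qed

text \<open>Summation by parts: each edge occurs in both orientations, whence the factor 1/2. The
  right-hand side is symmetric in \<open>f\<close> and \<open>g\<close>, which gives the
  self-adjointness behind the eigenvalue equation.\<close>

lemma lap_form_bilinear:
  assumes "simple_graph G"
  shows "(\<Sum>v\<in>fst G. g v * lap G f v) =
    (\<Sum>(v, u) | v \<in> fst G \<and> u \<in> fst G \<and> snd G v u. (g v - g u) * (f v - f u)) / 2"
proof -
  have fin: "finite (fst G)"
    using assms by (simp add: simple_graph_def)
  let ?P = "{(v, u). v \<in> fst G \<and> u \<in> fst G \<and> snd G v u}"
  have "(\<Sum>v\<in>fst G. g v * lap G f v) = (\<Sum>(v, u)\<in>Sigma (fst G) (\<lambda>v. {u \<in> fst G. snd G v u}). g v * (f v - f u))"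
    using fin by (simp add: lap_def sum_distrib_left sum.Sigma)
  also have "Sigma (fst G) (\<lambda>v. {u \<in> fst G. snd G v u}) = ?P"
    by auto
  finally have 1: "(\<Sum>v\<in>fst G. g v * lap G f v) = (\<Sum>(v, u)\<in>?P. g v * (f v - f u))" .
  also have "\<dots> = (\<Sum>(v, u)\<in>?P. g u * (f u - f v))"
    using assms by (intro sum.reindex_bij_witness[where i = prod.swap and j = prod.swap])
      (auto simp: simple_graph_def)
  finally have "2 * (\<Sum>v\<in>fst G. g v * lap G f v) =
      (\<Sum>(v, u)\<in>?P. g v * (f v - f u)) + (\<Sum>(v, u)\<in>?P. g u * (f u - f v))"
    using 1 by simp
  also have "\<dots> = (\<Sum>(v, u)\<in>?P. (g v - g u) * (f v - f u))"
    unfolding sum.distrib[symmetric] by (intro sum.cong) (auto simp: algebra_simps)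
  finally show ?thesis
    by simp
qed

lemma lap_form_eq_sum_squares:
  assumes "simple_graph G"
  shows "lap_form G f =
    (\<Sum>(v, u) | v \<in> fst G \<and> u \<in> fst G \<and> snd G v u. (f v - f u)\<^sup>2) / 2"
  unfolding lap_form_def lap_form_bilinear[OF assms] by (simp add: power2_eq_square)

lemma lap_form_cong: "(\<And>v. v \<in> fst G \<Longrightarrow> f v = g v) \<Longrightarrow> lap_form G f = lap_form G g"
  unfolding lap_form_def lap_def by (intro sum.cong arg_cong2[where f = "(*)"]) auto

section \<open>Attainment of the maximal Rayleigh quotient\<close>

lemma linear_coeff_zero:
  fixes a c :: real
  assumes "\<And>t. t * a + t\<^sup>2 * c \<le> 0"
  shows "a = 0"
proof (rule ccontr)
  assume "a \<noteq> 0"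
  \<comment> \<open>With this choice the linear term is
    \<open>t\<^sup>2 * (\<bar>c\<bar> + 1)\<close> and outweighs the quadratic one whatever the sign
    of \<open>c\<close>.\<close>
  define t where "t = a / (\<bar>c\<bar> + 1)"
  have t: "(\<bar>c\<bar> + 1) * t = a"
    by (simp add: t_def)
  with \<open>a \<noteq> 0\<close> have "t \<noteq> 0" by auto
  have "t * a + t\<^sup>2 * c = t\<^sup>2 * (\<bar>c\<bar> + 1 + c)"
    by (subst t[symmetric]) (simp add: power2_eq_square algebra_simps)
  moreover have "\<dots> > 0"
    using \<open>t \<noteq> 0\<close> by (intro mult_pos_pos) auto
  ultimately show False
    using assms[of t] by simp
qed

text \<open>Forcing the functions to vanish off \<open>V\<close> makes the sphere a closed subset of
  a product of copies of \<open>{-1..1}\<close> and \<open>{0}\<close>, which is compact by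
  Tychonoff.\<close>

lemma compact_unit_sphere_functions:
  fixes V :: "'a set"
  assumes "finite V"
  shows "compact {f :: 'a \<Rightarrow> real. (\<forall>v. v \<notin> V \<longrightarrow> f v = 0) \<and> (\<Sum>v\<in>V. (f v)\<^sup>2) = 1}"
proof -
  let ?C = "\<lambda>v. if v \<in> V then {-1..1::real} else {0}"
  have "compactin (product_topology (\<lambda>_. euclidean) UNIV) (PiE UNIV ?C)"
    unfolding compactin_PiE by (auto simp: compactin_euclidean_iff)
  then have "compact (PiE UNIV ?C)"
    by (simp add: euclidean_product_topology compactin_euclidean_iff)
  moreover have "closed {f :: 'a \<Rightarrow> real. (\<Sum>v\<in>V. (f v)\<^sup>2) = 1}"
    by (intro closed_Collect_eq continuous_on_sum continuous_on_power continuous_on_const)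
      (rule continuous_on_product_coordinates)
  ultimately have "compact (PiE UNIV ?C \<inter> {f. (\<Sum>v\<in>V. (f v)\<^sup>2) = 1})"
    by (rule compact_Int_closed)
  also have "PiE UNIV ?C \<inter> {f. (\<Sum>v\<in>V. (f v)\<^sup>2) = 1} =
      {f. (\<forall>v. v \<notin> V \<longrightarrow> f v = 0) \<and> (\<Sum>v\<in>V. (f v)\<^sup>2) = 1}"
  proof -
    have "f v \<in> {-1..1}" if "(\<Sum>v\<in>V. (f v)\<^sup>2) = 1" "v \<in> V" for f :: "'a \<Rightarrow> real" and v
    proof -
      have "(f v)\<^sup>2 \<le> 1"
        using member_le_sum[of v V "\<lambda>v. (f v)\<^sup>2"] that assms by simp
      then show ?thesis
        by (simp add: abs_square_le_1 abs_le_iff)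
    qed
    then show ?thesis
      by (auto simp: PiE_UNIV_domain Pi_iff split: if_splits)
  qed
  finally show ?thesis .
qed

text \<open>A maximizer of the form on the unit sphere is an eigenfunction, since the first
  variation vanishes there in every coordinate direction. This takes the place of the spectral
  theorem.\<close>

lemma lap_form_max_eigenvalue:
  fixes G :: "'a graph"
  assumes "simple_graph G" and "fst G \<noteq> {}"
  obtains M f where "\<And>g. lap_form G g \<le> M * (\<Sum>v\<in>fst G. (g v)\<^sup>2)"
    and "\<exists>v\<in>fst G. f v \<noteq> 0" and "\<And>v. v \<in> fst G \<Longrightarrow> lap G f v = M * f v"
proof -
  let ?V = "fst G"
  have fin: "finite ?V"
    using assms by (simp add: simple_graph_def)
  let ?K = "{f :: 'a \<Rightarrow> real. (\<forall>v. v \<notin> ?V \<longrightarrow> f v = 0) \<and> (\<Sum>v\<in>?V. (f v)\<^sup>2) = 1}"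
  obtain w where w: "w \<in> ?V"
    using assms by auto
  have "(\<lambda>v. if v = w then 1 else 0) \<in> ?K"
    using w fin by (auto simp: if_distrib[of "\<lambda>x. x\<^sup>2"] cong: if_cong)
  then have "?K \<noteq> {}"
    by (metis (no_types, lifting) empty_iff)
  have coord: "continuous_on ?K (\<lambda>f. f v)" for v
    by (rule continuous_on_subset[OF continuous_on_product_coordinates]) simp
  have "continuous_on ?K (lap_form G)"
    unfolding lap_form_def lap_def
    by (intro continuous_on_sum continuous_on_mult continuous_on_diff coord)
  from continuous_attains_sup[OF compact_unit_sphere_functions[OF fin] \<open>?K \<noteq> {}\<close> this]
  obtain f where f: "f \<in> ?K" and max: "\<And>g. g \<in> ?K \<Longrightarrow> lap_form G g \<le> lap_form G f"
    by (elim bexE) simp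
  define M where "M = lap_form G f"
  have le: "lap_form G g \<le> M * (\<Sum>v\<in>?V. (g v)\<^sup>2)" for g
  proof (cases "(\<Sum>v\<in>?V. (g v)\<^sup>2) = 0")
    case True
    then have "\<And>v. v \<in> ?V \<Longrightarrow> g v = 0"
      using fin by (simp add: sum_nonneg_eq_0_iff)
    then show ?thesis
      by (simp add: lap_form_def)
  next
    case False
    define N where "N = sqrt (\<Sum>v\<in>?V. (g v)\<^sup>2)"
    have N2: "N\<^sup>2 = (\<Sum>v\<in>?V. (g v)\<^sup>2)"
      by (simp add: N_def sum_nonneg)
    with False have "N \<noteq> 0" by auto
    define h where "h v = (if v \<in> ?V then g v / N else 0)" for v
    have "(\<Sum>v\<in>?V. (h v)\<^sup>2) = (\<Sum>v\<in>?V. (g v)\<^sup>2) / N\<^sup>2"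
      by (simp add: h_def power_divide sum_divide_distrib)
    then have "h \<in> ?K"
      using \<open>N \<noteq> 0\<close> N2 by (auto simp: h_def)
    then have "lap_form G h \<le> M"
      using max M_def by simp
    moreover have "lap_form G h = lap_form G g / N\<^sup>2"
    proof -
      have scale: "lap G (\<lambda>v. g v / N) v = lap G g v / N" for v
        unfolding lap_def sum_divide_distrib by (intro sum.cong) (auto simp: diff_divide_distrib)
      have "lap_form G h = lap_form G (\<lambda>v. g v / N)"
        by (rule lap_form_cong) (simp add: h_def)
      also have "\<dots> = lap_form G g / N\<^sup>2"
        by (simp add: lap_form_def scale sum_divide_distrib power2_eq_square)
      finally show ?thesis .
    qed
    ultimately show ?thesis
      using \<open>N \<noteq> 0\<close> unfolding N2[symmetric] by (simp add: pos_divide_le_eq)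
  qed
  have "lap G f v = M * f v" if v: "v \<in> ?V" for v
  proof -
    define g where "g u = (if u = v then 1 else 0 :: real)" for u
    have gl: "(\<Sum>u\<in>?V. g u * h u) = h v" for h :: "'a \<Rightarrow> real"
    proof -
      have "g u * h u = (if u = v then h u else 0)" for u
        by (simp add: g_def)
      then show ?thesis
        using v fin by simp
    qed
    have sym: "(\<Sum>u\<in>?V. f u * lap G g u) = (\<Sum>u\<in>?V. g u * lap G f u)"
      unfolding lap_form_bilinear[OF assms(1)] by (simp add: mult.commute)
    \<comment> \<open>This is \<open>le\<close> at \<open>f + t * g\<close>, expanded in
      \<open>t\<close>; the constant terms cancel because \<open>f\<close> attains \<open>M\<close>
      on the unit sphere.\<close>
    have "t * (2 * (lap G f v - M * f v)) + t\<^sup>2 * (lap_form G g - M * (\<Sum>u\<in>?V. (g u)\<^sup>2)) \<le> 0" for t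
    proof -
      have lin: "lap G (\<lambda>u. f u + t * g u) u = lap G f u + t * lap G g u" for u
        unfolding lap_def sum_distrib_left sum.distrib[symmetric]
        by (intro sum.cong) (auto simp: algebra_simps)
      have "lap_form G (\<lambda>u. f u + t * g u) = lap_form G f + t * ((\<Sum>u\<in>?V. f u * lap G g u)
          + (\<Sum>u\<in>?V. g u * lap G f u)) + t\<^sup>2 * lap_form G g"
        unfolding lap_form_def lin sum.distrib[symmetric] sum_distrib_left
        by (intro sum.cong) (auto simp: algebra_simps power2_eq_square)
      moreover have "(\<Sum>u\<in>?V. (f u + t * g u)\<^sup>2) = (\<Sum>u\<in>?V. (f u)\<^sup>2) + 2 * t * (\<Sum>u\<in>?V. g u * f u)
          + t\<^sup>2 * (\<Sum>u\<in>?V. (g u)\<^sup>2)"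
        unfolding sum.distrib[symmetric] sum_distrib_left
        by (intro sum.cong) (auto simp: algebra_simps power2_eq_square)
      ultimately show ?thesis
        using le[of "\<lambda>u. f u + t * g u"] f sym gl M_def by (simp add: algebra_simps)
    qed
    then have "2 * (lap G f v - M * f v) = 0"
      by (rule linear_coeff_zero)
    then show ?thesis by simp
  qed
  moreover have "\<exists>v\<in>?V. f v \<noteq> 0"
  proof (rule ccontr)
    assume "\<not> ?thesis"
    then have "(\<Sum>v\<in>?V. (f v)\<^sup>2) = 0" by simp
    with f show False by simp
  qed
  ultimately show ?thesis
    using that le by blast
qed

text \<open>Any bound for the Rayleigh quotient bounds every eigenvalue, and the maximal quotient is
  itself an eigenvalue; finiteness of the spectrum makes \<open>Max\<close> meaningful.\<close>

lemma
  assumes "simple_graph G" and "fst G \<noteq> {}"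
  shows lap_form_le_rho_L: "lap_form G f \<le> rho_L G * (\<Sum>v\<in>fst G. (f v)\<^sup>2)"
    and rho_L_le: "(\<And>f. lap_form G f \<le> m * (\<Sum>v\<in>fst G. (f v)\<^sup>2)) \<Longrightarrow> rho_L G \<le> m"
proof -
  let ?V = "fst G"
  have fin: "finite ?V"
    using assms by (simp add: simple_graph_def)
  define vs where "vs = (SOME vs. distinct vs \<and> set vs = fst G)"
  have vs: "distinct vs" "set vs = ?V"
    using someI_ex[of "\<lambda>vs. distinct vs \<and> set vs = fst G"] finite_distinct_list[OF fin]
    unfolding vs_def by blast+
  define L where "L = laplacian_matrix vs (snd G)"
  have "L \<in> carrier_mat (length vs) (length vs)"
    by (auto simp: L_def laplacian_matrix_def degree_matrix_def adjacency_matrix_def)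
  then have finL: "finite (spectrum L)"
    by (rule card_finite_spectrum)
  have L: "m \<in> spectrum L \<longleftrightarrow> (\<exists>f. (\<exists>v\<in>?V. f v \<noteq> 0) \<and> (\<forall>v\<in>?V. lap G f v = m * f v))" for m
    using spectrum_laplacian_matrix_iff[OF vs(1), of m "snd G"] by (simp add: vs(2) L_def)
  have rho: "rho_L G = Max (spectrum L)"
    by (simp add: rho_L_def L_def vs_def)
  have eigen_le: "k \<le> m" if k: "k \<in> spectrum L" and "\<And>f. lap_form G f \<le> m * (\<Sum>v\<in>?V. (f v)\<^sup>2)" for k m
  proof -
    obtain f v where f: "v \<in> ?V" "f v \<noteq> 0" "\<And>v. v \<in> ?V \<Longrightarrow> lap G f v = k * f v"
      using k unfolding L by blast
    have "lap_form G f = k * (\<Sum>v\<in>?V. (f v)\<^sup>2)"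
      using f(3) by (simp add: lap_form_def sum_distrib_left power2_eq_square mult.left_commute)
    moreover have "(\<Sum>v\<in>?V. (f v)\<^sup>2) > 0"
      using f(1,2) fin by (intro sum_pos2[of _ v]) auto
    ultimately show ?thesis
      using that(2)[of f] by simp
  qed
  obtain M f0 where M: "\<And>g. lap_form G g \<le> M * (\<Sum>v\<in>fst G. (g v)\<^sup>2)"
    "\<exists>v\<in>fst G. f0 v \<noteq> 0" "\<And>v. v \<in> fst G \<Longrightarrow> lap G f0 v = M * f0 v"
    using lap_form_max_eigenvalue[OF assms] by metis
  then have "M \<in> spectrum L"
    unfolding L by metis
  then have "rho_L G = M"
    unfolding rho using finL eigen_le[OF _ M(1)] by (intro Max_eqI) auto
  then show "lap_form G f \<le> rho_L G * (\<Sum>v\<in>fst G. (f v)\<^sup>2)"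
    using M(1) by simp
  show "rho_L G \<le> m" if "\<And>f. lap_form G f \<le> m * (\<Sum>v\<in>fst G. (f v)\<^sup>2)"
    using eigen_le[OF \<open>M \<in> spectrum L\<close> that] \<open>rho_L G = M\<close> by simp
qed

text \<open>Extending a test function by zero along \<open>\<phi>\<close> keeps its norm, and
  additional edges of \<open>H\<close> only add squares. An injection rather than an inclusion is
  allowed so that a leaf can be moved onto the spine later.\<close>

lemma rho_L_mono:
  assumes "simple_graph G" "simple_graph H" and "fst G \<noteq> {}"
    and inj: "inj_on \<phi> (fst G)" and sub: "\<phi> ` fst G \<subseteq> fst H"
    and adj: "\<And>u v. u \<in> fst G \<Longrightarrow> v \<in> fst G \<Longrightarrow> snd G u v \<Longrightarrow> snd H (\<phi> u) (\<phi> v)"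
  shows "rho_L G \<le> rho_L H"
proof (rule rho_L_le[OF assms(1,3)])
  fix f :: "'a \<Rightarrow> real"
  define g where "g v = (if v \<in> \<phi> ` fst G then f (the_inv_into (fst G) \<phi> v) else 0)" for v
  have g: "g (\<phi> v) = f v" if "v \<in> fst G" for v
    using that by (simp add: g_def the_inv_into_f_f[OF inj])
  let ?P = "{(v, u). v \<in> fst G \<and> u \<in> fst G \<and> snd G v u}"
  let ?Q = "{(v, u). v \<in> fst H \<and> u \<in> fst H \<and> snd H v u}"
  have finH: "finite (fst H)"
    using assms(2) by (simp add: simple_graph_def)
  have finQ: "finite ?Q"
    by (rule finite_subset[of _ "fst H \<times> fst H"]) (auto simp: finH)
  have "(\<Sum>(v, u)\<in>?P. (f v - f u)\<^sup>2) = (\<Sum>p\<in>?P. (\<lambda>(v, u). (g v - g u)\<^sup>2) (map_prod \<phi> \<phi> p))"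
    by (intro sum.cong) (auto simp: g)
  also have "\<dots> = (\<Sum>(v, u)\<in>map_prod \<phi> \<phi> ` ?P. (g v - g u)\<^sup>2)"
    using inj by (subst sum.reindex) (auto simp: inj_on_def)
  also have "\<dots> \<le> (\<Sum>(v, u)\<in>?Q. (g v - g u)\<^sup>2)"
    using sub adj by (intro sum_mono2 finQ) auto
  finally have "lap_form G f \<le> lap_form H g"
    using assms by (simp add: lap_form_eq_sum_squares)
  also have "\<dots> \<le> rho_L H * (\<Sum>v\<in>fst H. (g v)\<^sup>2)"
    using assms by (intro lap_form_le_rho_L) auto
  also have "(\<Sum>v\<in>fst H. (g v)\<^sup>2) = (\<Sum>v\<in>\<phi> ` fst G. (g v)\<^sup>2)"
    using sub by (intro sum.mono_neutral_right finH) (auto simp: g_def)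
  also have "\<dots> = (\<Sum>v\<in>fst G. (f v)\<^sup>2)"
    using inj by (simp add: sum.reindex g)
  finally show "lap_form G f \<le> rho_L H * (\<Sum>v\<in>fst G. (f v)\<^sup>2)" .
qed

subsection \<open>Super- and subsolutions on linear trees\<close>

lemma linear_tree_vertices_iff [simp]:
  "Spine j \<in> linear_tree_vertices Ts \<longleftrightarrow> j < length Ts"
  "Branch j i m \<in> linear_tree_vertices Ts \<longleftrightarrow>
    j < length Ts \<and> i < length (Ts ! j) \<and> m < Ts ! j ! i"
  by (auto simp: linear_tree_vertices_def)

lemma finite_linear_tree_vertices: "finite (linear_tree_vertices Ts)"
  using simple_graph_linear_tree[of Ts] by (simp add: simple_graph_def linear_tree_def)

lemma linear_tree_nonempty:
  assumes "Ts \<noteq> []"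
  shows "fst (linear_tree Ts) \<noteq> {}"
proof -
  have "Spine 0 \<in> fst (linear_tree Ts)"
    using assms by (simp add: linear_tree_def)
  then show ?thesis
    by (metis empty_iff)
qed

lemma next_vertex_asym: "next_vertex u v \<Longrightarrow> \<not> next_vertex v u"
  by (cases u; cases v) auto

abbreviation tree_edges :: "nat list list \<Rightarrow> (vertex \<times> vertex) set" where
  "tree_edges Ts \<equiv>
    {(u, v). u \<in> linear_tree_vertices Ts \<and> v \<in> linear_tree_vertices Ts \<and> next_vertex u v}"

lemma finite_tree_edges: "finite (tree_edges Ts)"
  by (rule finite_subset[of _ "linear_tree_vertices Ts \<times> linear_tree_vertices Ts"])
    (auto simp: finite_linear_tree_vertices)

lemma lap_form_linear_tree:
  "lap_form (linear_tree Ts) f = (\<Sum>(u, v)\<in>tree_edges Ts. (f u - f v)\<^sup>2)"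
proof -
  let ?N = "tree_edges Ts"
  let ?g = "\<lambda>(u, v). (f u - f v)\<^sup>2"
  have "{(v, u). v \<in> fst (linear_tree Ts) \<and> u \<in> fst (linear_tree Ts) \<and> snd (linear_tree Ts) v u} =
      ?N \<union> prod.swap ` ?N"
    by (auto simp: linear_tree_def image_iff)
  moreover have "sum ?g (?N \<union> prod.swap ` ?N) = sum ?g ?N + sum ?g (prod.swap ` ?N)"
    using next_vertex_asym by (intro sum.union_disjoint finite_imageI finite_tree_edges) auto
  moreover have "sum ?g (prod.swap ` ?N) = sum ?g ?N"
    by (subst sum.reindex) (auto simp: inj_on_def power2_commute intro!: sum.cong)
  ultimately show ?thesis
    by (simp add: lap_form_eq_sum_squares[OF simple_graph_linear_tree])
qed

text \<open>Coefficient of \<open>(f v)\<^sup>2\<close> after every edge has been split with the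
  weight of its head.\<close>

definition load :: "nat list list \<Rightarrow> (vertex \<Rightarrow> real) \<Rightarrow> vertex \<Rightarrow> real" where
  "load Ts W v = (\<Sum>u | u \<in> linear_tree_vertices Ts \<and> next_vertex v u. 1 + W u) +
    (\<Sum>u | u \<in> linear_tree_vertices Ts \<and> next_vertex u v. 1 + 1 / W v)"

lemma sum_tree_edges_eq_load:
  "(\<Sum>(u, v)\<in>tree_edges Ts. (1 + W v) * (f u)\<^sup>2 + (1 + 1 / W v) * (f v)\<^sup>2) =
    (\<Sum>v\<in>linear_tree_vertices Ts. load Ts W v * (f v)\<^sup>2)"
proof -
  let ?V = "linear_tree_vertices Ts"
  have "(\<Sum>(u, v)\<in>tree_edges Ts. (1 + W v) * (f u)\<^sup>2) =
      (\<Sum>(u, v)\<in>Sigma ?V (\<lambda>u. {v \<in> ?V. next_vertex u v}). (1 + W v) * (f u)\<^sup>2)"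
    by (intro sum.cong) auto
  also have "\<dots> = (\<Sum>u\<in>?V. (\<Sum>v | v \<in> ?V \<and> next_vertex u v. 1 + W v) * (f u)\<^sup>2)"
    unfolding sum_distrib_right by (subst sum.Sigma[symmetric]) (auto simp: finite_linear_tree_vertices)
  finally have 1: "(\<Sum>(u, v)\<in>tree_edges Ts. (1 + W v) * (f u)\<^sup>2) =
      (\<Sum>u\<in>?V. (\<Sum>v | v \<in> ?V \<and> next_vertex u v. 1 + W v) * (f u)\<^sup>2)" .
  have "(\<Sum>(u, v)\<in>tree_edges Ts. (1 + 1 / W v) * (f v)\<^sup>2) =
      (\<Sum>(v, u)\<in>Sigma ?V (\<lambda>v. {u \<in> ?V. next_vertex u v}). (1 + 1 / W v) * (f v)\<^sup>2)"
    by (intro sum.reindex_bij_witness[where i = prod.swap and j = prod.swap]) auto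
  also have "\<dots> = (\<Sum>v\<in>?V. (\<Sum>u | u \<in> ?V \<and> next_vertex u v. 1 + 1 / W v) * (f v)\<^sup>2)"
    unfolding sum_distrib_right by (subst sum.Sigma[symmetric]) (auto simp: finite_linear_tree_vertices)
  finally have 2: "(\<Sum>(u, v)\<in>tree_edges Ts. (1 + 1 / W v) * (f v)\<^sup>2) =
      (\<Sum>v\<in>?V. (\<Sum>u | u \<in> ?V \<and> next_vertex u v. 1 + 1 / W v) * (f v)\<^sup>2)" .
  have "(\<Sum>(u, v)\<in>tree_edges Ts. (1 + W v) * (f u)\<^sup>2 + (1 + 1 / W v) * (f v)\<^sup>2) =
      (\<Sum>(u, v)\<in>tree_edges Ts. (1 + W v) * (f u)\<^sup>2) + (\<Sum>(u, v)\<in>tree_edges Ts. (1 + 1 / W v) * (f v)\<^sup>2)"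
    by (simp add: sum.distrib case_prod_beta)
  also have "\<dots> = (\<Sum>v\<in>?V. load Ts W v * (f v)\<^sup>2)"
    unfolding 1 2 load_def by (simp only: distrib_right[of _ _ "(f _)\<^sup>2"] sum.distrib[of _ _ ?V])
  finally show ?thesis .
qed

section \<open>Weights from the recursions on branches and spine\<close>

lemma b_seq_1 [simp]: "b_seq \<mu> (Suc 0) = 1 - \<mu>"
  by (simp add: b_seq_def)

lemma b_seq_Suc: "n > 0 \<Longrightarrow> b_seq \<mu> (Suc n) = psi \<mu> (b_seq \<mu> n)"
  by (cases n) (simp_all add: b_seq_def)

text \<open>For \<open>\<mu> \<ge> 4\<close> the map \<open>psi \<mu>\<close> sends values at most
  -1 to values at most -1. This makes all branch weights positive.\<close>

lemma b_seq_le: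
  assumes "\<mu> \<ge> 4" and "n > 0"
  shows "b_seq \<mu> n \<le> -1"
  using assms(2)
proof (induction n rule: nat_induct_non_zero)
  case 1
  then show ?case
    using assms(1) by simp
next
  case (Suc n)
  then have "- 1 / b_seq \<mu> n \<le> 1"
    by (simp add: field_simps)
  then show ?case
    using assms(1) Suc.hyps by (simp add: b_seq_Suc psi_def)
qed

text \<open>Fits the geometry of \<open>linear_tree\<close> for every list: a path without vertices
  adds nothing wherever it stands, also in lists that are not \<open>starlike\<close>, such as the
  \<open>[]\<close> of a leafless classic vertex.\<close>

definition branch_delta :: "nat list \<Rightarrow> real \<Rightarrow> real" where
  "branch_delta T \<mu> = (\<Sum>i<length T. if T ! i = 0 then 0 else 1 - 1 / b_seq \<mu> (T ! i))"

lemma branch_delta_eq_delta: "starlike T \<Longrightarrow> branch_delta T \<mu> = delta T \<mu>"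
  unfolding starlike_def
proof (elim disjE conjE)
  assume "T \<noteq> []" "\<forall>q\<in>set T. 0 < q"
  moreover from this have "T \<noteq> [0]" by auto
  ultimately show ?thesis
    by (auto simp: branch_delta_def delta_def sum_list_sum_nth atLeast0LessThan all_set_conv_all_nth
        intro!: sum.cong)
qed (simp add: branch_delta_def delta_def)

lemma branch_delta_replicate_1:
  assumes "\<mu> > 1"
  shows "branch_delta (replicate r (Suc 0)) \<mu> = real r * (\<mu> / (\<mu> - 1))"
proof -
  have "1 - 1 / (1 - \<mu>) = \<mu> / (\<mu> - 1)"
    using assms by (simp add: field_simps)
  then show ?thesis
    by (simp add: branch_delta_def)
qed

text \<open>The weight belongs to the edge entering the vertex; the value at \<open>Spine 0\<close> is junk.\<close>

fun edge_weight :: "real \<Rightarrow> nat list list \<Rightarrow> (nat \<Rightarrow> real) \<Rightarrow> vertex \<Rightarrow> real" where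
  "edge_weight \<mu> Ts s (Spine j) = - s (j - 1)"
| "edge_weight \<mu> Ts s (Branch j i m) = - 1 / b_seq \<mu> (Ts ! j ! i - m)"

text \<open>With \<open>n + 1\<close> vertices left on the path, the load is
  \<open>(1 - b_seq \<mu> (Suc n)) + (1 - 1 / b_seq \<mu> n)\<close>, which equals
  \<open>\<mu>\<close> by the recursion; at the end of the path only
  \<open>1 - b_seq \<mu> 1 = \<mu>\<close> remains.\<close>

lemma load_Branch:
  assumes "\<mu> \<ge> 4" and v: "Branch j i m \<in> linear_tree_vertices Ts"
  shows "load Ts (edge_weight \<mu> Ts s) (Branch j i m) = \<mu>"
proof -
  let ?V = "linear_tree_vertices Ts" and ?q = "Ts ! j ! i"
  have "{u. u \<in> ?V \<and> next_vertex u (Branch j i m)} = {if m = 0 then Spine j else Branch j i (m - 1)}"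
    using v
  proof (intro equalityI subsetI)
    fix u
    assume "u \<in> {u. u \<in> ?V \<and> next_vertex u (Branch j i m)}"
    then show "u \<in> {if m = 0 then Spine j else Branch j i (m - 1)}"
      by (cases u) auto
  qed (auto split: if_splits)
  then have in_sum: "(\<Sum>u | u \<in> ?V \<and> next_vertex u (Branch j i m). c) = c" for c :: real
    by simp
  have out: "{u. u \<in> ?V \<and> next_vertex (Branch j i m) u} = (if Suc m < ?q then {Branch j i (Suc m)} else {})"
    using v
  proof (intro equalityI subsetI)
    fix u
    assume "u \<in> {u. u \<in> ?V \<and> next_vertex (Branch j i m) u}"
    then show "u \<in> (if Suc m < ?q then {Branch j i (Suc m)} else {})"
      by (cases u) auto
  qed (auto split: if_splits)
  have mq: "m < ?q"
    using v by simp
  show ?thesis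
  proof (cases "Suc m < ?q")
    case True
    define n where "n = ?q - Suc m"
    have n: "?q - m = Suc n" "n > 0"
      using True by (auto simp: n_def)
    then show ?thesis
      using True unfolding load_def in_sum out
      by (simp add: n_def[symmetric] b_seq_Suc psi_def)
  next
    case False
    then have "?q - m = Suc 0"
      using mq by simp
    then show ?thesis
      using False unfolding load_def in_sum out by simp
  qed
qed

lemma load_Spine:
  assumes j: "j < length Ts"
  shows "load Ts (edge_weight \<mu> Ts s) (Spine j) =
    (if Suc j < length Ts then 1 - s j else 0) + branch_delta (Ts ! j) \<mu>
      + (if j = 0 then 0 else 1 - 1 / s (j - 1))"
proof -
  let ?V = "linear_tree_vertices Ts" and ?W = "edge_weight \<mu> Ts s"
  let ?I = "{i. i < length (Ts ! j) \<and> Ts ! j ! i \<noteq> 0}"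
  have "{u. u \<in> ?V \<and> next_vertex u (Spine j)} = (if j = 0 then {} else {Spine (j - 1)})"
    using j
  proof (intro equalityI subsetI)
    fix u
    assume "u \<in> {u. u \<in> ?V \<and> next_vertex u (Spine j)}"
    then show "u \<in> (if j = 0 then {} else {Spine (j - 1)})"
      by (cases u) auto
  qed (auto split: if_splits)
  then have in_sum: "(\<Sum>u | u \<in> ?V \<and> next_vertex u (Spine j). c) = (if j = 0 then 0 else c)" for c :: real
    by simp
  let ?S = "if Suc j < length Ts then {Spine (Suc j)} else {}"
  have "{u. u \<in> ?V \<and> next_vertex (Spine j) u} = ?S \<union> (\<lambda>i. Branch j i 0) ` ?I"
    using j
  proof (intro equalityI subsetI)
    fix u
    assume "u \<in> {u. u \<in> ?V \<and> next_vertex (Spine j) u}"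
    then show "u \<in> ?S \<union> (\<lambda>i. Branch j i 0) ` ?I"
      by (cases u) auto
  qed (auto split: if_splits)
  then have "(\<Sum>u | u \<in> ?V \<and> next_vertex (Spine j) u. 1 + ?W u) =
      (\<Sum>u\<in>?S. 1 + ?W u) + (\<Sum>u\<in>(\<lambda>i. Branch j i 0) ` ?I. 1 + ?W u)"
    by (simp only:) (rule sum.union_disjoint, auto)
  also have "(\<Sum>u\<in>(\<lambda>i. Branch j i 0) ` ?I. 1 + ?W u) = (\<Sum>i\<in>?I. 1 - 1 / b_seq \<mu> (Ts ! j ! i))"
    by (subst sum.reindex) (auto simp: inj_on_def)
  also have "\<dots> = branch_delta (Ts ! j) \<mu>"
    unfolding branch_delta_def by (rule sum.mono_neutral_cong_left) auto
  finally show ?thesis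
    unfolding load_def in_sum by simp
qed

text \<open>The inequalities for \<open>s\<close> say that every spine load is at most
  \<open>\<mu>\<close>. The last vertex lacks the outgoing term \<open>1 - s j\<close>, so there the
  bound 1 replaces negativity.\<close>

lemma rho_L_linear_tree_le:
  assumes "\<mu> \<ge> 4" and "Ts \<noteq> []"
    and s0: "1 - \<mu> + branch_delta (Ts ! 0) \<mu> \<le> s 0"
    and sS: "\<And>j. Suc j < length Ts \<Longrightarrow> psi \<mu> (s j) + branch_delta (Ts ! Suc j) \<mu> \<le> s (Suc j)"
    and neg: "\<And>j. Suc j < length Ts \<Longrightarrow> s j < 0"
    and last: "s (length Ts - 1) \<le> 1"
  shows "rho_L (linear_tree Ts) \<le> \<mu>"
proof -
  let ?V = "linear_tree_vertices Ts" and ?W = "edge_weight \<mu> Ts s"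
  have W: "?W v > 0" if uv: "(u, v) \<in> tree_edges Ts" for u v
  proof (cases v)
    case (Spine j)
    then obtain i where "u = Spine i" "j = Suc i"
      using uv Spine by (cases u) auto
    then show ?thesis
      using that Spine neg[of i] by simp
  next
    case (Branch j i m)
    then have "b_seq \<mu> (Ts ! j ! i - m) \<le> -1"
      using that assms(1) by (intro b_seq_le) auto
    then show ?thesis
      using Branch by (simp add: divide_less_0_iff)
  qed
  have load: "load Ts ?W v \<le> \<mu>" if "v \<in> ?V" for v
  proof (cases v)
    case (Spine j)
    then have j: "j < length Ts"
      using that by simp
    have last': "s j \<le> 1" if "\<not> Suc j < length Ts"
    proof -
      have "j = length Ts - 1"
        using that j by simp
      then show ?thesis
        using last by simp
    qed
    show ?thesis
    proof (cases j)
      case 0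
      then show ?thesis
        using Spine s0 last' load_Spine[OF j, of \<mu> s] by (cases "Suc 0 < length Ts") auto
    next
      case (Suc i)
      then show ?thesis
        using Spine j sS[of i] last' load_Spine[OF j, of \<mu> s]
        by (cases "Suc j < length Ts") (auto simp: psi_def)
    qed
  next
    case (Branch j i m)
    then show ?thesis
      using load_Branch[OF assms(1)] that by simp
  qed
  have edge: "(x - y)\<^sup>2 \<le> (1 + w) * x\<^sup>2 + (1 + 1 / w) * y\<^sup>2" if "w > 0" for x y w :: real
  proof -
    have "(1 + w) * x\<^sup>2 + (1 + 1 / w) * y\<^sup>2 - (x - y)\<^sup>2 = (w * x + y)\<^sup>2 / w"
      using that by (simp add: field_simps power2_eq_square)
    then show ?thesis
      using that by (smt (verit) divide_nonneg_pos zero_le_power2)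
  qed
  show ?thesis
  proof (rule rho_L_le[OF simple_graph_linear_tree])
    show "fst (linear_tree Ts) \<noteq> {}"
      using assms(2) by (rule linear_tree_nonempty)
    fix f
    have "lap_form (linear_tree Ts) f \<le>
        (\<Sum>(u, v)\<in>tree_edges Ts. (1 + ?W v) * (f u)\<^sup>2 + (1 + 1 / ?W v) * (f v)\<^sup>2)"
      unfolding lap_form_linear_tree
    proof (intro sum_mono)
      fix e
      assume e: "e \<in> tree_edges Ts"
      show "(case e of (u, v) \<Rightarrow> (f u - f v)\<^sup>2) \<le>
          (case e of (u, v) \<Rightarrow> (1 + ?W v) * (f u)\<^sup>2 + (1 + 1 / ?W v) * (f v)\<^sup>2)"
      proof (cases e)
        case (Pair u v)
        then show ?thesis
          using edge[OF W[of u v]] e by simp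
      qed
    qed
    also have "\<dots> \<le> \<mu> * (\<Sum>v\<in>?V. (f v)\<^sup>2)"
      unfolding sum_tree_edges_eq_load sum_distrib_left
      using load by (intro sum_mono mult_right_mono) auto
    finally show "lap_form (linear_tree Ts) f \<le> \<mu> * (\<Sum>v\<in>fst (linear_tree Ts). (f v)\<^sup>2)"
      by (simp add: linear_tree_def)
  qed
qed

text \<open>A test function living on the spine up to \<open>Spine j\<close> and on its branches
  makes all edge splittings exact, with loads at least \<open>\<mu>\<close> wherever it is nonzero.
  One further spine vertex is required because the edge to it contributes 1 to the load at
  \<open>Spine j\<close>.\<close>

lemma le_rho_L_linear_tree:
  assumes "\<mu> \<ge> 4" and j: "Suc j < length Ts"
    and s0: "s 0 \<le> 1 - \<mu> + branch_delta (Ts ! 0) \<mu>"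
    and sS: "\<And>i. i < j \<Longrightarrow> s (Suc i) \<le> psi \<mu> (s i) + branch_delta (Ts ! Suc i) \<mu>"
    and neg: "\<And>i. i < j \<Longrightarrow> s i < 0"
    and sj: "0 \<le> s j"
  shows "\<mu> \<le> rho_L (linear_tree Ts)"
proof -
  let ?V = "linear_tree_vertices Ts"
  \<comment> \<open>Lowering \<open>s j\<close> to 0 still leaves a load of at least
    \<open>\<mu>\<close> at \<open>Spine j\<close>, and weight 0 on the next edge makes the test
    function vanish from there on.\<close>
  define s' where "s' i = (if i < j then s i else 0)" for i
  let ?W = "edge_weight \<mu> Ts s'"
  \<comment> \<open>Normalised by \<open>g j = 1\<close>, so that the test function is
    nonzero.\<close>
  define g where "g i = (if i \<le> j then \<Prod>l=i..<j. 1 / s l else 0)" for i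
  have g_Suc: "g (Suc i) = s' i * g i" for i
    using neg[of i] by (auto simp: g_def s'_def prod.atLeast_Suc_lessThan)
  define f where "f v = (case v of Spine i \<Rightarrow> g i
    | Branch i a m \<Rightarrow> g i * (\<Prod>l\<le>m. 1 / b_seq \<mu> (Ts ! i ! a - l)))" for v
  have f_simps: "f (Spine i) = g i"
    "f (Branch i a m) = g i * (\<Prod>l\<le>m. 1 / b_seq \<mu> (Ts ! i ! a - l))" for i a m
    by (simp_all add: f_def)
  have f_next: "f v = - ?W v * f u \<and> (f v \<noteq> 0 \<longrightarrow> ?W v \<noteq> 0)" if uv: "(u, v) \<in> tree_edges Ts" for u v
  proof (cases v)
    case (Spine k)
    then obtain i where "u = Spine i" "k = Suc i"
      using uv Spine by (cases u) auto
    then show ?thesis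
      using Spine by (simp add: f_simps g_Suc)
  next
    case (Branch k i m)
    then have b: "b_seq \<mu> (Ts ! k ! i - m) \<le> -1"
      using that assms(1) by (intro b_seq_le) auto
    show ?thesis
    proof (cases u)
      case (Spine k')
      then have "k' = k" "m = 0"
        using that Branch by auto
      then show ?thesis
        using Spine Branch b by (simp add: f_simps)
    next
      case u: (Branch k' i' m')
      then have "k' = k" "i' = i" "m = Suc m'"
        using that Branch by auto
      then show ?thesis
        using u Branch b by (simp add: f_simps)
    qed
  qed
  \<comment> \<open>For \<open>w = 0\<close> also \<open>y = 0\<close>, so the junk value
    \<open>1 / 0\<close> is harmless.\<close>
  have edge: "(x - y)\<^sup>2 = (1 + w) * x\<^sup>2 + (1 + 1 / w) * y\<^sup>2" if "y = - w * x \<and> (y \<noteq> 0 \<longrightarrow> w \<noteq> 0)" for x y w :: real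
    using that by (cases "w = 0") (auto simp: field_simps power2_eq_square)
  have load: "\<mu> * (f v)\<^sup>2 \<le> load Ts ?W v * (f v)\<^sup>2" if "v \<in> ?V" for v
  proof (cases v)
    case (Spine i)
    show ?thesis
    proof (cases "i \<le> j")
      case True
      then have "load Ts ?W v = 1 - s' i + branch_delta (Ts ! i) \<mu> + (if i = 0 then 0 else 1 - 1 / s' (i - 1))"
        using j Spine load_Spine[of i Ts \<mu> s'] by simp
      then have "\<mu> \<le> load Ts ?W v"
        using True s0 sS[of "i - 1"] sj by (cases i; cases "i = j") (auto simp: s'_def psi_def)
      then show ?thesis
        by (intro mult_right_mono) auto
    qed (simp add: Spine f_simps g_def)
  next
    case (Branch j i m)
    then show ?thesis
      using load_Branch[OF assms(1)] that by simp
  qed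
  have "Ts \<noteq> []"
    using j by auto
  have "\<mu> * (\<Sum>v\<in>?V. (f v)\<^sup>2) \<le> (\<Sum>v\<in>?V. load Ts ?W v * (f v)\<^sup>2)"
    unfolding sum_distrib_left using load by (rule sum_mono)
  also have "\<dots> = lap_form (linear_tree Ts) f"
    unfolding lap_form_linear_tree sum_tree_edges_eq_load[symmetric]
    using edge[OF f_next] by (intro sum.cong) auto
  also have "\<dots> \<le> rho_L (linear_tree Ts) * (\<Sum>v\<in>?V. (f v)\<^sup>2)"
    using lap_form_le_rho_L[OF simple_graph_linear_tree, OF linear_tree_nonempty[OF \<open>Ts \<noteq> []\<close>], of f]
    by (simp add: linear_tree_def)
  finally have "\<mu> * (\<Sum>v\<in>?V. (f v)\<^sup>2) \<le> rho_L (linear_tree Ts) * (\<Sum>v\<in>?V. (f v)\<^sup>2)" .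
  moreover have "(\<Sum>v\<in>?V. (f v)\<^sup>2) > 0"
    using j by (intro sum_pos2[of _ "Spine j"] finite_linear_tree_vertices) (auto simp: f_simps g_def)
  ultimately show ?thesis
    by simp
qed

lemma rho_L_linear_tree_mono:
  assumes "Ts \<noteq> []" and "linear_tree_vertices Ts \<subseteq> linear_tree_vertices Us"
  shows "rho_L (linear_tree Ts) \<le> rho_L (linear_tree Us)"
  using assms by (intro rho_L_mono[where \<phi> = "\<lambda>v. v"] simple_graph_linear_tree linear_tree_nonempty)
    (auto simp: linear_tree_def)

subsection \<open>The random process\<close>

lemma psi_mono: "s \<le> t \<Longrightarrow> t < 0 \<Longrightarrow> psi \<mu> s \<le> psi \<mu> t"
  by (simp add: psi_def divide_inverse inverse_le_iff_le_neg)

lemma psi_strict_mono: "s < t \<Longrightarrow> t < 0 \<Longrightarrow> psi \<mu> s < psi \<mu> t"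
  by (simp add: psi_def divide_inverse inverse_less_iff_less_neg)

lemma theta_le:
  assumes "\<mu> \<ge> 4"
  shows "theta \<mu> \<le> -1"
proof -
  have "(2::real)\<^sup>2 \<le> (\<mu> - 2)\<^sup>2"
    using assms by (intro power_mono) auto
  then have "0 \<le> sqrt ((\<mu> - 2)\<^sup>2 - 4)"
    by simp
  then show ?thesis
    unfolding theta_def using assms by argo
qed

lemma theta'_bounds:
  assumes "\<mu> \<ge> 4"
  shows "theta' \<mu> < 0" and "-1 \<le> theta' \<mu>"
  using theta_le[OF assms] by (auto simp: theta'_def field_simps)

text \<open>\<open>theta \<mu>\<close> and its inverse are the two roots of
  \<open>t\<^sup>2 + (\<mu> - 2) * t + 1\<close>, the equation for fixed points of
  \<open>psi \<mu>\<close>.\<close>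

lemma psi_theta':
  assumes "\<mu> \<ge> 4"
  shows "psi \<mu> (theta' \<mu>) = theta' \<mu>"
proof -
  let ?r = "sqrt ((\<mu> - 2)\<^sup>2 - 4)"
  have "(2::real)\<^sup>2 \<le> (\<mu> - 2)\<^sup>2"
    using assms by (intro power_mono) auto
  then have r: "?r * ?r = (\<mu> - 2) * (\<mu> - 2) - 4"
    by (simp add: power2_eq_square)
  have quad: "theta \<mu> * theta \<mu> + (\<mu> - 2) * theta \<mu> + 1 = 0"
    unfolding theta_def using r by (simp add: field_simps)
  have "theta \<mu> \<noteq> 0"
    using theta_le[OF assms] by simp
  then have "inverse (theta \<mu>) = 2 - \<mu> - theta \<mu>"
    using quad by (simp add: field_simps)
  moreover have "1 / inverse (theta \<mu>) = theta \<mu>"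
    by (simp add: divide_inverse)
  ultimately show ?thesis
    by (simp only: psi_def theta'_def)
qed

lemma theta'_ge:
  assumes "\<mu> \<ge> 5"
  shows "-1/2 \<le> theta' \<mu>"
proof -
  have "(3::real)\<^sup>2 \<le> (\<mu> - 2)\<^sup>2"
    using assms by (intro power_mono) auto
  then have "1 \<le> sqrt ((\<mu> - 2)\<^sup>2 - 4)"
    by simp
  then have "theta \<mu> \<le> -2"
    unfolding theta_def using assms by argo
  then show ?thesis
    by (simp add: theta'_def field_simps)
qed

lemma process_G_mono: "0 < k \<Longrightarrow> k \<le> l \<Longrightarrow> rho_L (process_G T k) \<le> rho_L (process_G T l)"
  unfolding process_G_def
proof (rule rho_L_linear_tree_mono, simp, rule subsetI)
  fix v
  show "v \<in> linear_tree_vertices (map T [0..<l])"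
    if "k \<le> l" "v \<in> linear_tree_vertices (map T [0..<k])"
    using that by (cases v) auto
qed

text \<open>The process values are an exact supersolution, negative because they stay below
  \<open>theta' \<mu>\<close>.\<close>

lemma rho_L_process_G_le:
  assumes "\<mu> \<ge> 4" and "realization \<mu> T"
  shows "rho_L (process_G T (Suc k)) \<le> \<mu>"
proof -
  have S: "starlike (T j)" "process_S \<mu> T j < 0" for j
    using assms theta'_bounds(1)[OF assms(1)] by (auto simp: realization_def theta'_def intro: less_trans)
  show ?thesis
    unfolding process_G_def
  proof (rule rho_L_linear_tree_le[OF assms(1), where s = "process_S \<mu> T"])
    show "process_S \<mu> T (length (map T [0..<Suc k]) - 1) \<le> 1"
      using S(2)[of k] by simp
  qed (use S in \<open>simp_all add: branch_delta_eq_delta del: upt_Suc\<close>)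
qed

text \<open>The sequence increases and is bounded by \<open>\<mu>\<close>. It starts at
  \<open>Suc k\<close> because \<open>process_G T 0\<close> is the empty graph, whose spectrum is
  empty.\<close>

lemma process_limit_exists:
  assumes "\<mu> \<ge> 4" and "realization \<mu> T" and "m \<le> rho_L (process_G T (Suc k))"
  obtains x where "process_limit \<mu> x" and "m \<le> x" and "x \<le> \<mu>"
proof -
  let ?a = "\<lambda>k. rho_L (process_G T (Suc k))"
  have "incseq ?a"
    by (intro incseq_SucI process_G_mono) auto
  then obtain x where x: "?a \<longlonglongrightarrow> x" "\<And>i. ?a i \<le> x"
    using incseq_convergent[of ?a \<mu>] rho_L_process_G_le[OF assms(1,2)] by blast
  have "process_limit \<mu> x"
    unfolding process_limit_def
    using assms(2) x(1) filterlim_sequentially_Suc[of "\<lambda>k. rho_L (process_G T k)"] by auto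
  moreover have "x \<le> \<mu>"
    using x(1) rho_L_process_G_le[OF assms(1,2)] by (intro LIMSEQ_le_const2[OF x(1)]) auto
  ultimately show ?thesis
    using that x(2)[of k] assms(3) by force
qed

section \<open>An explicit realization at 5.4\<close>

definition witness_T :: "nat \<Rightarrow> nat list" where
  "witness_T j = (if j = 0 then [1, 1, 1] else if j \<le> 2 then [2] else if j = 3 then [1] else [0])"

lemma starlike_witness_T: "starlike (witness_T j)"
  by (simp add: starlike_def witness_T_def)

lemma process_S_witness_T:
  "process_S \<mu> witness_T 0 = 1 - \<mu> + 3 * (1 - 1 / (1 - \<mu>))"
  "process_S \<mu> witness_T (Suc 0) = psi \<mu> (process_S \<mu> witness_T 0) + (1 - 1 / psi \<mu> (1 - \<mu>))"
  "process_S \<mu> witness_T (Suc (Suc 0)) =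
    psi \<mu> (process_S \<mu> witness_T (Suc 0)) + (1 - 1 / psi \<mu> (1 - \<mu>))"
  "process_S \<mu> witness_T (Suc (Suc (Suc 0))) =
    psi \<mu> (process_S \<mu> witness_T (Suc (Suc 0))) + (1 - 1 / (1 - \<mu>))"
  by (simp_all add: witness_T_def delta_def b_seq_def)

lemma realization_witness_T: "realization 5.4 witness_T"
proof -
  let ?S = "process_S 5.4 witness_T"
  have t: "-1/2 \<le> theta' 5.4" "theta' 5.4 < 0"
    by (rule theta'_ge theta'_bounds; simp)+
  \<comment> \<open>The values are about -0.72, -0.69, -0.64 and -0.61, so the crude bound -1/2
    suffices.\<close>
  have S: "?S 0 < theta' 5.4 \<and> ?S 1 < theta' 5.4 \<and> ?S 2 < theta' 5.4 \<and> ?S 3 < theta' 5.4"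
    using t(1) by (simp add: numeral_eq_Suc process_S_witness_T psi_def del: process_S.simps)
  have "?S j < theta' 5.4" for j
  proof (induction j)
    case (Suc j)
    show ?case
    proof (cases "j < 3")
      case True
      then have "j = 0 \<or> j = 1 \<or> j = 2" by auto
      then show ?thesis
        using S by (auto simp: numeral_eq_Suc)
    next
      \<comment> \<open>No branches remain, so strict monotonicity of \<open>psi\<close> below its
        fixed point preserves the bound.\<close>
      case False
      then have "?S (Suc j) = psi 5.4 (?S j)"
        by (simp add: witness_T_def delta_def)
      also have "\<dots> < psi 5.4 (theta' 5.4)"
        using Suc t(2) by (rule psi_strict_mono)
      finally show ?thesis
        by (simp add: psi_theta')
    qed
  qed (use S in simp)
  then show ?thesis
    by (simp add: realization_def starlike_witness_T theta'_def)
qed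

text \<open>At the smaller parameter 5.374 the same trees give about -0.69, -0.60, -0.40 and 0.37.
  The fifth vertex is the one required beyond the crossing at index 3.\<close>

lemma le_rho_L_witness: "5.374 \<le> rho_L (process_G witness_T 5)"
  unfolding process_G_def
proof (rule le_rho_L_linear_tree[where j = 3 and s = "process_S 5.374 witness_T"])
  let ?S = "process_S 5.374 witness_T"
  have S: "?S 0 < 0 \<and> ?S 1 < 0 \<and> ?S 2 < 0 \<and> 0 \<le> ?S 3"
    by (simp add: numeral_eq_Suc process_S_witness_T psi_def del: process_S.simps)
  show "?S i < 0" if "i < 3" for i
  proof -
    have "i = 0 \<or> i = 1 \<or> i = 2"
      using that by auto
    then show ?thesis
      using S by auto
  qed
  show "0 \<le> ?S 3"
    using S by simp
qed (simp_all add: branch_delta_eq_delta starlike_witness_T del: upt_Suc)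

lemma process_limit_witness: obtains x where "process_limit 5.4 x" "5.374 \<le> x" "x \<le> 5.4"
proof -
  have "(4::real) \<le> 5.4" and "5.374 \<le> rho_L (process_G witness_T (Suc 4))"
    using le_rho_L_witness by simp_all
  then show ?thesis
    using process_limit_exists[OF _ realization_witness_T] that by metis
qed

section \<open>Numerical bounds for the constants\<close>

lemma mu_min_bounds: "4 \<le> mu_min" "mu_min < 5.373"
proof -
  have s: "5 \<le> sqrt 33" "sqrt 33 \<le> 6"
    by (rule real_le_rsqrt real_le_lsqrt; simp)+
  define a b where "a = root 3 (19 + 3 * sqrt 33)" and "b = root 3 (19 - 3 * sqrt 33)"
  have "2 \<le> a" "a \<le> 4"
    unfolding a_def using s real_root_le_mono[of 3 "2 ^ 3" "19 + 3 * sqrt 33"]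
      real_root_le_mono[of 3 "19 + 3 * sqrt 33" "4 ^ 3"] by (simp_all only: real_root_power_cancel) auto
  moreover have "0 \<le> b" "b \<le> 2"
    unfolding b_def using s real_root_ge_zero[of "19 - 3 * sqrt 33" 3]
      real_root_le_mono[of 3 "19 - 3 * sqrt 33" "2 ^ 3"]
    by (simp_all only: real_root_power_cancel) auto
  ultimately have w: "1 \<le> omega \<and> omega \<le> 7 / 3"
    by (simp add: omega_def a_def[symmetric] b_def[symmetric])
  then have "inverse omega \<le> 1"
    by (simp add: field_simps)
  then show "mu_min < 5.373"
    using w by (simp add: mu_min_def)
  have "0 \<le> (omega - 1)\<^sup>2 / omega"
    using w by simp
  also have "\<dots> = omega + inverse omega - 2"
    using w by (simp add: field_simps power2_eq_square)
  finally show "4 \<le> mu_min"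
    by (simp add: mu_min_def)
qed

lemma mu_lower_less: "mu_lower < 5.374"
proof -
  \<comment> \<open>Here 5.748 is \<open>2 * 5.374 - 5\<close>.\<close>
  have "sqrt 33 < 5.748"
    by (rule real_less_lsqrt) (simp_all add: power2_eq_square)
  then show ?thesis
    by (simp add: mu_lower_def)
qed

lemma mu_upper_greater: "5.4 < mu_upper"
proof -
  let ?p = "[:-1, -10, 19, -14, 2:] :: real poly"
  obtain x where x: "5.4 < x" "poly ?p x = 0"
    using poly_IVT_pos[of "5.4" 6 ?p] by auto
  have "x \<le> mu_upper"
    unfolding mu_upper_def using x poly_roots_finite[of ?p] by (intro Max_ge) auto
  with x(1) show ?thesis by simp
qed

subsection \<open>The classic process\<close>

lemma leaf_count_le:
  assumes "\<mu> > 1" and "t \<le> c"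
  shows "real (leaf_count \<mu> c t) * (\<mu> / (\<mu> - 1)) \<le> c - t"
proof -
  have "real (leaf_count \<mu> c t) \<le> (\<mu> - 1) / \<mu> * (c - t)"
    using assms unfolding leaf_count_def by (intro of_nat_floor) auto
  then show ?thesis
    using assms by (simp add: field_simps)
qed

lemma le_leaf_count:
  assumes "\<mu> > 1" and "real n * (\<mu> / (\<mu> - 1)) \<le> c - t"
  shows "n \<le> leaf_count \<mu> c t"
proof -
  have "real n \<le> (\<mu> - 1) / \<mu> * (c - t)"
    using assms by (simp add: field_simps)
  then show ?thesis
    unfolding leaf_count_def by (simp add: le_nat_floor)
qed

text \<open>The factor \<open>(\<mu> - 1) / \<mu>\<close> is below 1, so raising the target by 1
  raises the argument of the floor by less than 1.\<close>

lemma leaf_count_add_1_le: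
  assumes "\<mu> > 1"
  shows "leaf_count \<mu> (c + 1) t \<le> leaf_count \<mu> c t + 1"
proof -
  have "(\<mu> - 1) / \<mu> * (c + 1 - t) \<le> (\<mu> - 1) / \<mu> * (c - t) + 1"
    using assms by (simp add: field_simps)
  then have "\<lfloor>(\<mu> - 1) / \<mu> * (c + 1 - t)\<rfloor> \<le> \<lfloor>(\<mu> - 1) / \<mu> * (c - t)\<rfloor> + 1"
    by linarith
  then show ?thesis
    unfolding leaf_count_def by linarith
qed

lemma classic_S_0: "classic_S \<mu> 0 = 1 - \<mu> + real (classic_r \<mu> 0) * (\<mu> / (\<mu> - 1))"
  by simp

lemma classic_S_Suc:
  "classic_S \<mu> (Suc j) = psi \<mu> (classic_S \<mu> j) + real (classic_r \<mu> (Suc j)) * (\<mu> / (\<mu> - 1))"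
  by simp

text \<open>Since \<open>theta' \<mu>\<close> is a fixed point of \<open>psi \<mu>\<close>, which
  increases on negative values, the value before attaching leaves does not exceed the target, and
  the floor fills the gap without overshooting.\<close>

lemma classic_S_le:
  assumes "\<mu> \<ge> 4"
  shows "classic_S \<mu> j \<le> theta' \<mu>"
proof (induction j)
  case 0
  then show ?case
    using leaf_count_le[of \<mu> "1 - \<mu>" "theta' \<mu>"] theta'_bounds[OF assms] assms by simp
next
  case (Suc j)
  then have "psi \<mu> (classic_S \<mu> j) \<le> theta' \<mu>"
    using psi_mono[of "classic_S \<mu> j" "theta' \<mu>" \<mu>] psi_theta'[OF assms] theta'_bounds[OF assms] by simp
  then show ?case
    using leaf_count_le[of \<mu> "psi \<mu> (classic_S \<mu> j)" "theta' \<mu>"] assms by simp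
qed

lemma classic_S_neg: "\<mu> \<ge> 4 \<Longrightarrow> classic_S \<mu> j < 0"
  using classic_S_le[of \<mu> j] theta'_bounds(1)[of \<mu>] by simp

text \<open>Before leaves are attached every value is at least \<open>1 - \<mu>\<close>, and the
  target is negative. The uniform bound lets one larger parameter serve the whole run.\<close>

lemma classic_r_le:
  assumes "\<mu> \<ge> 4"
  shows "real (classic_r \<mu> j) \<le> \<mu>"
proof -
  have *: "real (leaf_count \<mu> (theta' \<mu>) t) \<le> \<mu>" if "1 - \<mu> \<le> t" for t
  proof -
    have "(\<mu> - 1) / \<mu> * (theta' \<mu> - t) \<le> 1 * \<mu>"
    proof (cases "theta' \<mu> - t \<ge> 0")
      case True
      then show ?thesis
        using assms that theta'_bounds[OF assms] by (intro mult_mono) auto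
    next
      case False
      then have "(\<mu> - 1) / \<mu> * (theta' \<mu> - t) \<le> 0"
        using assms by (intro mult_nonneg_nonpos) auto
      then show ?thesis
        using assms by simp
    qed
    then show ?thesis
      unfolding leaf_count_def using assms by linarith
  qed
  have "1 - \<mu> \<le> psi \<mu> s" if "s < 0" for s
    using that by (simp add: psi_def add_increasing2)
  then show ?thesis
    using *[of "1 - \<mu>"] *[of "psi \<mu> (classic_S \<mu> (j - 1))"] classic_S_neg[OF assms, of "j - 1"]
    by (cases j) auto
qed

text \<open>The index is that of the last regular value, so the graph has \<open>n + 2\<close> spine
  vertices.\<close>

definition classic_last :: "real \<Rightarrow> nat \<Rightarrow> nat" where
  "classic_last \<mu> n = leaf_count \<mu> (theta' \<mu> + 1) (psi \<mu> (classic_S \<mu> n))"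

lemma classic_last_le:
  assumes "\<mu> \<ge> 4"
  shows "classic_last \<mu> n \<le> classic_r \<mu> (Suc n) + 1"
  using leaf_count_add_1_le[of \<mu> "theta' \<mu>"] assms by (simp add: classic_last_def)

definition classic_Ts :: "real \<Rightarrow> nat \<Rightarrow> nat list list" where
  "classic_Ts \<mu> n = map (\<lambda>r. replicate r 1) (map (classic_r \<mu>) [0..<Suc n] @ [classic_last \<mu> n])"

lemma classic_G_eq: "classic_G \<mu> (Suc (Suc n)) = linear_tree (classic_Ts \<mu> n)"
  by (simp add: classic_G_def caterpillar_def classic_Ts_def classic_last_def)

lemma length_classic_Ts [simp]: "length (classic_Ts \<mu> n) = Suc (Suc n)"
  by (simp add: classic_Ts_def)

lemma nth_classic_Ts:
  "j \<le> n \<Longrightarrow> classic_Ts \<mu> n ! j = replicate (classic_r \<mu> j) 1"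
  "classic_Ts \<mu> n ! Suc n = replicate (classic_last \<mu> n) 1"
  by (auto simp: classic_Ts_def nth_append simp del: upt_Suc)

text \<open>The raised target \<open>theta' \<mu> + 1\<close> of the last vertex lies below 1,
  within the slack that a supersolution has there.\<close>

lemma rho_L_classic_G_le:
  assumes "\<mu> \<ge> 4"
  shows "rho_L (classic_G \<mu> (Suc (Suc n))) \<le> \<mu>"
  unfolding classic_G_eq
proof (rule rho_L_linear_tree_le[OF assms, where s = "\<lambda>j. if j \<le> n then classic_S \<mu> j else 1"])
  have last: "psi \<mu> (classic_S \<mu> n) + real (classic_last \<mu> n) * (\<mu> / (\<mu> - 1)) \<le> 1"
  proof -
    have "psi \<mu> (classic_S \<mu> n) \<le> psi \<mu> (theta' \<mu>)"
      using classic_S_le theta'_bounds assms by (intro psi_mono) auto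
    then have "real (classic_last \<mu> n) * (\<mu> / (\<mu> - 1)) \<le> theta' \<mu> + 1 - psi \<mu> (classic_S \<mu> n)"
      unfolding classic_last_def using assms by (intro leaf_count_le) (auto simp: psi_theta')
    then show ?thesis
      using theta'_bounds[OF assms] by simp
  qed
  fix j
  assume j: "Suc j < length (classic_Ts \<mu> n)"
  show "psi \<mu> (if j \<le> n then classic_S \<mu> j else 1) + branch_delta (classic_Ts \<mu> n ! Suc j) \<mu>
      \<le> (if Suc j \<le> n then classic_S \<mu> (Suc j) else 1)"
  proof (cases "j = n")
    case True
    then show ?thesis
      using last assms by (simp add: nth_classic_Ts branch_delta_replicate_1)
  next
    case False
    then show ?thesis
      using j assms by (simp add: nth_classic_Ts branch_delta_replicate_1)
  qed
  show "(if j \<le> n then classic_S \<mu> j else 1) < 0"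
    using j classic_S_neg[OF assms] by auto
next
  show "classic_Ts \<mu> n \<noteq> []"
    by (simp add: classic_Ts_def)
  show "1 - \<mu> + branch_delta (classic_Ts \<mu> n ! 0) \<mu> \<le> (if 0 \<le> n then classic_S \<mu> 0 else 1)"
    using assms by (simp add: nth_classic_Ts branch_delta_replicate_1)
qed simp

subsection \<open>Classic limits are limits of the random process\<close>

text \<open>\<open>[0]\<close> replaces the empty list, which \<open>starlike\<close>
  excludes.\<close>

definition classic_T :: "real \<Rightarrow> nat \<Rightarrow> nat list" where
  "classic_T \<mu> j = (if classic_r \<mu> j = 0 then [0] else replicate (classic_r \<mu> j) 1)"

lemma starlike_classic_T: "starlike (classic_T \<mu> j)"
  by (simp add: starlike_def classic_T_def)

lemma Branch_classic_T:
  "i < length (classic_T \<mu> j) \<and> m < classic_T \<mu> j ! i \<longleftrightarrow> i < classic_r \<mu> j \<and> m = 0"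
  by (auto simp: classic_T_def)

lemma delta_classic_T:
  assumes "\<mu>' > 1"
  shows "delta (classic_T \<mu> j) \<mu>' = real (classic_r \<mu> j) * (\<mu>' / (\<mu>' - 1))"
  using branch_delta_replicate_1[OF assms, of "classic_r \<mu> j"]
  by (simp add: branch_delta_eq_delta[OF starlike_classic_T, symmetric])
    (simp add: classic_T_def branch_delta_def)

lemma Branch_mem_process_classic_T [simp]:
  "Branch j i m \<in> linear_tree_vertices (map (classic_T \<mu>) [0..<k]) \<longleftrightarrow>
    j < k \<and> i < classic_r \<mu> j \<and> m = 0"
  by (cases "j < k") (simp_all add: Branch_classic_T)

lemma Branch_mem_classic_Ts:
  "Branch j i m \<in> linear_tree_vertices (classic_Ts \<mu> n) \<longleftrightarrow>
    (j \<le> n \<and> i < classic_r \<mu> j \<or> j = Suc n \<and> i < classic_last \<mu> n) \<and> m = 0"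
  by (cases "j \<le> n"; cases "j = Suc n") (auto simp: nth_classic_Ts)

lemma process_G_classic_T_le:
  "rho_L (process_G (classic_T \<mu>) (Suc n)) \<le> rho_L (classic_G \<mu> (Suc (Suc n)))"
  unfolding classic_G_eq process_G_def
proof (rule rho_L_linear_tree_mono)
  show "linear_tree_vertices (map (classic_T \<mu>) [0..<Suc n]) \<subseteq> linear_tree_vertices (classic_Ts \<mu> n)"
  proof
    fix v
    assume "v \<in> linear_tree_vertices (map (classic_T \<mu>) [0..<Suc n])"
    then show "v \<in> linear_tree_vertices (classic_Ts \<mu> n)"
      by (cases v) (auto simp: Branch_mem_classic_Ts less_Suc_eq_le
          simp del: upt_Suc linear_tree_vertices_iff(2) classic_r.simps)
  qed
qed simp

lemma classic_G_le_process_G: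
  assumes "\<mu> \<ge> 4"
  shows "rho_L (classic_G \<mu> (Suc (Suc n))) \<le> rho_L (process_G (classic_T \<mu>) (Suc (Suc (Suc n))))"
  unfolding classic_G_eq process_G_def
proof (rule rho_L_mono[OF simple_graph_linear_tree simple_graph_linear_tree])
  \<comment> \<open>The only leaf of the classic graph that the process tree may lack, as leaf
    indices start at 0.\<close>
  let ?l = "Branch (Suc n) (classic_r \<mu> (Suc n)) 0"
  let ?\<phi> = "\<lambda>v. if v = ?l then Spine (Suc (Suc n)) else v"
  let ?G = "linear_tree (classic_Ts \<mu> n)"
  let ?H = "linear_tree (map (classic_T \<mu>) [0..<Suc (Suc (Suc n))])"
  show "fst ?G \<noteq> {}"
    by (rule linear_tree_nonempty) (simp add: classic_Ts_def)
  show "inj_on ?\<phi> (fst ?G)"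
    by (auto simp: inj_on_def linear_tree_def)
  show "?\<phi> ` fst ?G \<subseteq> fst ?H"
  proof (rule image_subsetI)
    fix v
    assume v: "v \<in> fst ?G"
    show "?\<phi> v \<in> fst ?H"
    proof (cases v)
      case (Spine j)
      then show ?thesis
        using v by (simp add: linear_tree_def del: upt_Suc)
    next
      case (Branch j i m)
      then have "j \<le> n \<and> i < classic_r \<mu> j \<or> j = Suc n \<and> i < Suc (classic_r \<mu> (Suc n))" "m = 0"
        using v classic_last_le[OF assms, of n] by (auto simp: linear_tree_def Branch_mem_classic_Ts
          simp del: linear_tree_vertices_iff(2) classic_r.simps)
      then show ?thesis
        using Branch by (auto simp: linear_tree_def less_Suc_eq
          simp del: upt_Suc linear_tree_vertices_iff(2) classic_r.simps)
    qed
  qed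
  have next_\<phi>: "next_vertex (?\<phi> u) (?\<phi> v)" if "next_vertex u v" "v \<in> fst ?G" for u v
  proof (cases "v = ?l")
    case True
    then have "u = Spine (Suc n)"
      using that by (cases u) auto
    then show ?thesis
      using True by simp
  next
    case False
    \<comment> \<open>All classic branches have length 1, so a leaf has no successor.\<close>
    have "u \<noteq> ?l"
      using that by (cases v) (auto simp: linear_tree_def Branch_mem_classic_Ts
          simp del: linear_tree_vertices_iff(2) classic_r.simps)
    then show ?thesis
      using that False by simp
  qed
  show "snd ?H (?\<phi> u) (?\<phi> v)" if uv: "u \<in> fst ?G" "v \<in> fst ?G" "snd ?G u v" for u v
  proof -
    have "next_vertex u v \<or> next_vertex v u"
      using uv(3) by (simp add: linear_tree_def)
    then show ?thesis
      using next_\<phi>[of u v] next_\<phi>[of v u] uv(1,2) by (auto simp only: linear_tree_def snd_conv)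
  qed
qed

text \<open>The spectral radius with \<open>k + 3\<close> spine vertices in the process lies between
  the classic ones with \<open>k + 2\<close> and \<open>k + 4\<close>.\<close>

lemma process_limit_of_classic_limit:
  assumes "\<mu> \<ge> 4" and "classic_limit \<mu> x"
  shows "(\<lambda>k. rho_L (process_G (classic_T \<mu>) k)) \<longlonglongrightarrow> x"
proof (rule LIMSEQ_offset[where k = 3])
  have c: "(\<lambda>k. rho_L (classic_G \<mu> (k + a))) \<longlonglongrightarrow> x" for a
    using assms(2) unfolding classic_limit_def by (rule LIMSEQ_ignore_initial_segment)
  show "(\<lambda>k. rho_L (process_G (classic_T \<mu>) (k + 3))) \<longlonglongrightarrow> x"
  proof (rule tendsto_sandwich[OF _ _ c[of 2] c[of 4]])
    have "rho_L (classic_G \<mu> (k + 2)) \<le> rho_L (process_G (classic_T \<mu>) (k + 3))" for k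
      using classic_G_le_process_G[OF assms(1), of k] by (simp add: numeral_eq_Suc)
    then show "\<forall>\<^sub>F k in sequentially. rho_L (classic_G \<mu> (k + 2)) \<le> rho_L (process_G (classic_T \<mu>) (k + 3))"
      by simp
    have "rho_L (process_G (classic_T \<mu>) (k + 3)) \<le> rho_L (classic_G \<mu> (k + 4))" for k
      using process_G_classic_T_le[of \<mu> "Suc (Suc k)"] by (simp add: numeral_eq_Suc)
    then show "\<forall>\<^sub>F k in sequentially. rho_L (process_G (classic_T \<mu>) (k + 3)) \<le> rho_L (classic_G \<mu> (k + 4))"
      by simp
  qed
qed

text \<open>The leaf counts are at most \<open>\<mu>\<close>, so a parameter well above \<open>2 * \<mu>\<close> keeps every value of the
  process below \<open>-2\<close>.\<close>

lemma realization_classic_T: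
  assumes "\<mu> \<ge> 4"
  shows "realization (2 * \<mu> + 6) (classic_T \<mu>)"
proof -
  let ?m = "2 * \<mu> + 6"
  have d: "delta (classic_T \<mu> j) ?m \<le> 2 * \<mu>" for j
  proof -
    have "real (classic_r \<mu> j) * (?m / (?m - 1)) \<le> \<mu> * 2"
      using classic_r_le[OF assms, of j] assms by (intro mult_mono) (auto simp: field_simps)
    then show ?thesis
      using delta_classic_T[of ?m \<mu> j] assms by simp
  qed
  have S: "process_S ?m (classic_T \<mu>) j \<le> -2" for j
  proof (induction j)
    case 0
    then show ?case
      using d[of 0] by simp
  next
    case (Suc j)
    then have "- 1 / process_S ?m (classic_T \<mu>) j \<le> 1"
      by (simp add: field_simps)
    then show ?case
      using d[of "Suc j"] by (simp add: psi_def)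
  qed
  have "-1 \<le> theta' ?m"
    using assms by (intro theta'_bounds) simp
  then have "process_S ?m (classic_T \<mu>) j < inverse (theta ?m)" for j
    using S[of j] by (simp add: theta'_def)
  then show ?thesis
    by (simp add: realization_def starlike_classic_T)
qed

text \<open>The limit depends on the trees only, so the parameter may be enlarged. This avoids the
  equality of a classic value with \<open>theta' \<mu>\<close> and the case
  \<open>\<mu> = mu_min\<close>, both excluded in the random process.\<close>

lemma Omega1_subset_Omega: "Omega1 \<subseteq> Omega"
proof
  fix x
  assume "x \<in> Omega1"
  then obtain \<mu> where "x \<ge> mu_min" and \<mu>: "\<mu> \<ge> mu_min" "classic_limit \<mu> x"
    by (auto simp: Omega1_def)
  have "\<mu> \<ge> 4"
    using \<mu>(1) mu_min_bounds by simp
  then have "process_limit (2 * \<mu> + 6) x" "2 * \<mu> + 6 > mu_min"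
    using process_limit_of_classic_limit realization_classic_T \<mu>(2) mu_min_bounds
    by (auto simp: process_limit_def)
  with \<open>x \<ge> mu_min\<close> show "x \<in> Omega"
    by (auto simp: Omega_def)
qed

subsection \<open>A gap in the classic limits\<close>

lemma classic_r_0_ge:
  assumes "\<mu> \<ge> 5.373"
  shows "3 \<le> classic_r \<mu> 0"
proof -
  \<comment> \<open>The left side decreases in \<open>\<mu>\<close>; the bound is about 3.69, while
    the available room is at least 4.373 - 1/2.\<close>
  have "3 * (\<mu> / (\<mu> - 1)) \<le> 3 * (5.373 / 4.373)"
    using assms by (simp add: field_simps)
  then have "real 3 * (\<mu> / (\<mu> - 1)) \<le> theta' \<mu> - (1 - \<mu>)"
    using assms theta'_ge[of \<mu>] by simp
  then show ?thesis
    using assms by (simp add: le_leaf_count)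
qed

text \<open>Equality of both sides holds exactly at \<open>\<mu> = mu_lower\<close>, where \<open>[3, 1, 1, \<dots>]\<close> is stationary.\<close>

lemma psi_three_leaves_le:
  fixes \<mu> :: real
  assumes "\<mu> \<ge> 5.373" and p: "p = 1 - \<mu> + 3 * (\<mu> / (\<mu> - 1))"
  shows "p < 0" and "psi \<mu> p + \<mu> / (\<mu> - 1) \<le> p"
proof -
  define d where "d = \<mu> - 1"
  have d: "d \<ge> 4.373" "\<mu> = d + 1"
    using assms(1) by (auto simp: d_def)
  \<comment> \<open>The larger root of \<open>d\<^sup>2 - 3 * d - 6\<close> is
    \<open>mu_lower - 1\<close>, slightly below 4.373.\<close>
  have q: "d\<^sup>2 \<ge> 3 * d + 6"
  proof -
    have "4.373 * 1.373 \<le> d * (d - 3)"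
      using d(1) by (intro mult_mono) auto
    then show ?thesis
      by (simp add: power2_eq_square algebra_simps)
  qed
  have pd: "- p = (d\<^sup>2 - 3 * d - 3) / d"
    using d by (simp add: p field_simps power2_eq_square)
  have num: "d\<^sup>2 - 3 * d - 3 > 0"
    using q by simp
  then have "- p > 0"
    unfolding pd using d(1) by (intro divide_pos_pos) auto
  then show "p < 0" by simp
  have "0 \<le> d * (d\<^sup>2 - 3 * d - 6)"
    using d(1) q by (intro mult_nonneg_nonneg) auto
  then have "d * d \<le> (d + 2) * (d\<^sup>2 - 3 * d - 3)"
    using d(1) q by (simp add: algebra_simps power2_eq_square)
  then have "d / (d\<^sup>2 - 3 * d - 3) \<le> (d + 2) / d"
    using num d(1) by (simp add: field_simps)
  moreover have "- 1 / p = d / (d\<^sup>2 - 3 * d - 3)"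
    using pd num d(1) by (simp add: field_simps)
  moreover have "2 - \<mu> + \<mu> / (\<mu> - 1) - p = - ((d + 2) / d)"
    using d by (simp add: p field_simps)
  ultimately show "psi \<mu> p + \<mu> / (\<mu> - 1) \<le> p"
    unfolding psi_def by linarith
qed

text \<open>Along \<open>[3, 1, \<dots>, 1]\<close> the values never exceed the first value
  \<open>p\<close>, and by \<open>psi_three_leaves_le\<close> another leaf still fits below
  \<open>p\<close>, hence below the target.\<close>

lemma classic_r_pos_after_ones:
  assumes "\<mu> \<ge> 5.373" and "classic_r \<mu> 0 = 3" and "\<And>i. 0 < i \<Longrightarrow> i \<le> j \<Longrightarrow> classic_r \<mu> i = 1"
  shows "1 \<le> classic_r \<mu> (Suc j)"
proof -
  define p where "p = 1 - \<mu> + 3 * (\<mu> / (\<mu> - 1))"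
  note p = psi_three_leaves_le[OF assms(1) p_def]
  have S0: "classic_S \<mu> 0 = p"
    unfolding classic_S_0 assms(2) by (simp add: p_def)
  have S: "classic_S \<mu> i \<le> p" if "i \<le> j" for i
    using that
  proof (induction i)
    case (Suc i)
    then have "psi \<mu> (classic_S \<mu> i) \<le> psi \<mu> p"
      using p(1) by (intro psi_mono) auto
    moreover have "classic_r \<mu> (Suc i) = 1"
      using Suc.prems by (intro assms(3)) auto
    ultimately show ?case
      unfolding classic_S_Suc using p(2) by simp
  qed (use S0 in simp)
  have "psi \<mu> (classic_S \<mu> j) \<le> psi \<mu> p"
    using S[of j] p(1) by (intro psi_mono) auto
  moreover have "p \<le> theta' \<mu>"
    using classic_S_le[of \<mu> 0] assms(1) by (simp only: S0) simp
  ultimately have "real 1 * (\<mu> / (\<mu> - 1)) \<le> theta' \<mu> - psi \<mu> (classic_S \<mu> j)"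
    using p(2) by simp
  then show ?thesis
    using assms(1) unfolding classic_r.simps by (intro le_leaf_count) auto
qed

text \<open>At 5.401, just beyond the bound 5.4 for the witness limit, four leaves make the very
  first value positive.\<close>

lemma le_rho_L_classic_four_leaves:
  assumes "4 \<le> classic_r \<mu> 0"
  shows "5.401 \<le> rho_L (classic_G \<mu> (Suc (Suc n)))"
  unfolding classic_G_eq
proof (rule le_rho_L_linear_tree[where j = 0 and s = "\<lambda>_. 0"])
  have "4 * (5.401 / 4.401) \<le> real (classic_r \<mu> 0) * (5.401 / 4.401)"
    using assms by (intro mult_right_mono) auto
  then show "0 \<le> 1 - 5.401 + branch_delta (classic_Ts \<mu> n ! 0) 5.401"
    by (simp add: nth_classic_Ts branch_delta_replicate_1 del: classic_r.simps)
qed auto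

text \<open>At \<open>5.401\<close> a vertex with one leaf keeps values above \<open>-1.52\<close>; from there a vertex with two
  leaves lifts them above \<open>-0.289\<close>, and the next spine vertex makes them positive.\<close>

lemma le_rho_L_classic_two_leaves:
  assumes "3 \<le> classic_r \<mu> 0" and "\<And>i. i \<le> j \<Longrightarrow> 1 \<le> classic_r \<mu> i" and "2 \<le> classic_r \<mu> (Suc j)"
    and n: "Suc (Suc j) \<le> n"
  shows "5.401 \<le> rho_L (classic_G \<mu> (Suc (Suc n)))"
  unfolding classic_G_eq
proof (rule le_rho_L_linear_tree[where j = "Suc (Suc j)" and
      s = "\<lambda>i. if i \<le> j then -1.52 else if i = Suc j then -0.289 else 0"])
  have delta: "branch_delta (classic_Ts \<mu> n ! i) 5.401 \<ge> real k * (5.401 / 4.401)"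
    if "i \<le> n" "k \<le> classic_r \<mu> i" for i k
  proof -
    have "real k * (5.401 / 4.401) \<le> real (classic_r \<mu> i) * (5.401 / 4.401)"
      using that(2) by (intro mult_right_mono) auto
    then show ?thesis
      using that(1) by (simp add: nth_classic_Ts branch_delta_replicate_1)
  qed
  show "(if 0 \<le> j then -1.52 else if 0 = Suc j then -0.289 else 0)
      \<le> 1 - 5.401 + branch_delta (classic_Ts \<mu> n ! 0) 5.401"
    using delta[of 0 3] assms(1) by simp
  show "(if Suc i \<le> j then -1.52 else if Suc i = Suc j then -0.289 else 0)
      \<le> psi 5.401 (if i \<le> j then -1.52 else if i = Suc j then -0.289 else 0)
        + branch_delta (classic_Ts \<mu> n ! Suc i) 5.401"
    if i: "i < Suc (Suc j)" for i
  proof -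
    consider "Suc i \<le> j" | "i = j" | "i = Suc j"
      using i by linarith
    then show ?thesis
    proof cases
      case 1
      then show ?thesis
        using delta[of "Suc i" 1] assms(2)[of "Suc i"] n by (simp add: psi_def)
    next
      case 2
      then show ?thesis
        using delta[of "Suc i" 2] assms(3) n by (simp add: psi_def)
    next
      case 3
      then show ?thesis
        using delta[of "Suc i" 0] n by (simp add: psi_def)
    qed
  qed
qed (use n in auto)

text \<open>Since 5.373 exceeds \<open>mu_lower\<close>, the value after three leaves is a constant
  supersolution at 5.373, whatever \<open>\<mu>\<close> produced the counts. Up to two leaves at the
  last vertex keep the value there below 1.\<close>

lemma rho_L_classic_ones_le:
  assumes "classic_r \<mu> 0 = 3" and "\<And>i. 0 < i \<Longrightarrow> classic_r \<mu> i = 1" and "\<mu> \<ge> 4"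
  shows "rho_L (classic_G \<mu> (Suc (Suc n))) \<le> 5.373"
  unfolding classic_G_eq
proof (rule rho_L_linear_tree_le[where s = "\<lambda>j. if j \<le> n then 1 - 5.373 + 3 * (5.373 / 4.373) else 1"])
  have last: "real (classic_last \<mu> n) \<le> 2"
    using classic_last_le[OF assms(3), of n] assms(2)[of "Suc n"] by simp
  show "classic_Ts \<mu> n \<noteq> []"
    by (simp add: classic_Ts_def)
  show "1 - 5.373 + branch_delta (classic_Ts \<mu> n ! 0) 5.373
      \<le> (if 0 \<le> n then 1 - 5.373 + 3 * (5.373 / 4.373) else 1)"
    using assms(1) by (simp add: nth_classic_Ts branch_delta_replicate_1 del: classic_r.simps)
  fix j
  assume j: "Suc j < length (classic_Ts \<mu> n)"
  then have "j \<le> n" by simp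
  have leaves: "branch_delta (classic_Ts \<mu> n ! Suc j) 5.373 = real (classic_r \<mu> (Suc j)) * (5.373 / 4.373)"
    if "j < n"
    using that by (simp add: nth_classic_Ts branch_delta_replicate_1 del: classic_r.simps)
  from \<open>j \<le> n\<close> show "psi 5.373 (if j \<le> n then 1 - 5.373 + 3 * (5.373 / 4.373) else 1)
        + branch_delta (classic_Ts \<mu> n ! Suc j) 5.373
      \<le> (if Suc j \<le> n then 1 - 5.373 + 3 * (5.373 / 4.373) else 1)"
    using assms(2)[of "Suc j"] last leaves
    by (cases "j = n") (simp_all add: nth_classic_Ts(2) branch_delta_replicate_1 psi_def del: classic_r.simps)
  show "(if j \<le> n then 1 - 5.373 + 3 * (5.373 / 4.373) else 1) < (0::real)"
    using \<open>j \<le> n\<close> by simp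
qed auto

lemma classic_limit_gap:
  assumes "\<mu> \<ge> 4" and "classic_limit \<mu> x"
  shows "x \<le> 5.373 \<or> 5.401 \<le> x"
proof -
  have lim: "(\<lambda>n. rho_L (classic_G \<mu> (Suc (Suc n)))) \<longlonglongrightarrow> x"
    using LIMSEQ_ignore_initial_segment[OF assms(2)[unfolded classic_limit_def], of 2] by simp
  have "classic_r \<mu> 0 = 3 \<or> 4 \<le> classic_r \<mu> 0" if "\<mu> > 5.373"
    using classic_r_0_ge[of \<mu>] that by linarith
  moreover have "(\<forall>i>0. classic_r \<mu> i = 1) \<or> (\<exists>j. classic_r \<mu> (Suc j) \<noteq> 1)"
    by (metis gr0_conv_Suc)
  ultimately consider "\<mu> \<le> 5.373" | "\<mu> > 5.373" "4 \<le> classic_r \<mu> 0"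
    | "\<mu> > 5.373" "classic_r \<mu> 0 = 3" "\<forall>i>0. classic_r \<mu> i = 1"
    | "\<mu> > 5.373" "classic_r \<mu> 0 = 3" "\<exists>j. classic_r \<mu> (Suc j) \<noteq> 1"
    by (metis not_le)
  then show ?thesis
  proof cases
    case 1
    have "x \<le> \<mu>"
      using rho_L_classic_G_le[OF assms(1)] by (intro LIMSEQ_le_const2[OF lim]) auto
    with 1 show ?thesis by simp
  next
    case 2
    have "5.401 \<le> x"
      using le_rho_L_classic_four_leaves[OF 2(2)] by (intro LIMSEQ_le_const[OF lim]) auto
    then show ?thesis by simp
  next
    case 3
    have "x \<le> 5.373"
      using rho_L_classic_ones_le[OF 3(2) _ assms(1)] 3(3) by (intro LIMSEQ_le_const2[OF lim]) auto
    then show ?thesis by simp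
  next
    case 4
    \<comment> \<open>The first deviation from \<open>[3, 1, 1, \<dots>]\<close> cannot be to 0
      leaves, so it has at least two.\<close>
    define j where "j = (LEAST j. classic_r \<mu> (Suc j) \<noteq> 1)"
    have j: "classic_r \<mu> (Suc j) \<noteq> 1"
      unfolding j_def using 4(3) by (rule LeastI_ex)
    have ones: "classic_r \<mu> i = 1" if "0 < i" "i \<le> j" for i
      using that not_less_Least[of "i - 1" "\<lambda>j. classic_r \<mu> (Suc j) \<noteq> 1"] by (auto simp: j_def)
    have "1 \<le> classic_r \<mu> (Suc j)"
      using 4 ones by (intro classic_r_pos_after_ones) auto
    with j have "2 \<le> classic_r \<mu> (Suc j)" by linarith
    moreover have "1 \<le> classic_r \<mu> i" if "i \<le> j" for i
      using that ones[of i] 4(2) by (cases "i = 0") (auto simp del: classic_r.simps)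
    ultimately have "5.401 \<le> rho_L (classic_G \<mu> (Suc (Suc n)))" if "Suc (Suc j) \<le> n" for n
      using 4(2) that by (intro le_rho_L_classic_two_leaves) auto
    then have "5.401 \<le> x"
      by (intro LIMSEQ_le_const[OF lim]) auto
    then show ?thesis by simp
  qed
qed

theorem mainTheorem5:
  shows "(\<exists>x. process_limit 5.4 x \<and> mu_lower < x \<and> x < mu_upper) \<and> Omega1 \<subset> Omega"
proof -
  obtain x where x: "process_limit 5.4 x" "5.374 \<le> x" "x \<le> 5.4"
    by (rule process_limit_witness)
  have "mu_lower < x" "x < mu_upper"
    using x mu_lower_less mu_upper_greater by auto
  moreover have "x \<in> Omega"
    using x mu_min_bounds unfolding Omega_def by (intro CollectI conjI exI[of _ "5.4"]) auto
  moreover have "x \<notin> Omega1"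
  proof
    assume "x \<in> Omega1"
    then obtain \<mu> where "\<mu> \<ge> mu_min" "classic_limit \<mu> x"
      by (auto simp: Omega1_def)
    then have "x \<le> 5.373 \<or> 5.401 \<le> x"
      using mu_min_bounds by (intro classic_limit_gap) auto
    then show False
      using x by auto
  qed
  ultimately show ?thesis
    using x(1) Omega1_subset_Omega by (metis psubsetI)
qed

end
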